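(* Let $s \in \mathbb{R}$ and let $g(s) = \|G(0)^\dagger\|^{-1} - (L_G + L_f)s$, $\alpha(s) = \|G(0)^\dagger\|^{-1} - L_Gs$, and $\beta(s) = \mu\|G(0)^\dagger\|L_Gs$. Let $U\Sigma V^T$ be the singular value decomposition of $G(0)$, where $U = [\eta_1,\dots,\eta_n]$, and let $r = \mathrm{rank}(G(0))$. Define $\Lambda(s) = \mathrm{diag}(\lambda_i(s))$ by $\lambda_i(s) = \max\left\{\frac{g(s)}{\alpha(s)\|G(0)^\dagger \eta_i\| + \beta(s)},\, g(s),\, 0\right\}$ for $i = 1,\dots,r$ and $\lambda_i(s) = 0$ elsewhere. The reachable set of $$\dot{x} \in P(\mathcal{S}(x)), \qquad x(0) = x_0,$$ equals the reachable set of the control system $$\dot{x} = a + U\Lambda(\|x\|)u, \qquad x(0) = x_0,$$ on $\{x \mid \|x\| \leq \|G(0)^\dagger\|^{-1}/(L_f + L_G)\}$, with $a = f(0)$ and $u \in \{u \mid \|u\|_1 \leq 1\}\cap \mathrm{Im}(G(0)^T)$. If $\hat{\mathcal{R}}(T,x_0)$ denotes the reachable set of this control system, then $\hat{\mathcal{R}}(T,x_0) \subseteq \mathcal{R}^{\mathcal{G}}(T,x_0)$.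
   Context: Notation: $\|v\|$ is the Euclidean norm and $\|v\|_1$ the 1-norm of a vector $v$; $\|M\|=\max_{\|v\|=1}\|Mv\|$ for a matrix $M$; $M^T$ is the transpose and $M^\dagger$ the Moore-Penrose pseudoinverse; $\mathrm{Im}(M)$ is the range of $M$; $\mathbb{B}^n(a;b)$ is the closed Euclidean ball in $\mathbb{R}^n$ with center $a$ and radius $b\ge 0$. A function $h$ has Lipschitz constant $L$ if $\|h(x)-h(y)\|\le L\|x-y\|$ for all $x,y\in\mathbb{R}^n$. Singular values are listed in decreasing order, so $\eta_1,\dots,\eta_r$ are the left singular vectors of $G(0)$ for its nonzero singular values. $\Lambda(s)$ is the $n\times m$ (rectangular) diagonal matrix with diagonal entries $\lambda_i(s)$, so that $U\Lambda(\|x\|)u$ is defined for $u\in\mathrm{Im}(G(0)^T)\subseteq\mathbb{R}^m$. Setting: $T\ge 0$; $L_f>0$ and $L_G>0$ are given; $f:\mathbb{R}^n\to\mathbb{R}^n$ is Lipschitz with constant $L_f$ and $G:\mathbb{R}^n\to\mathbb{R}^{n\times m}$ is Lipschitz with constant $L_G$; $\mathcal{U}=\mathbb{B}^m(0;1)$; the initial state is $x_0=0$. There exist $R\in\mathbb{R}^{n\times m}$ and functions $\rho:\mathbb{R}^n\to\mathbb{R}^m$, $H:\mathbb{R}^n\to\mathbb{R}^{m\times m}$ with $f(x)=R\rho(x)$ and $G(x)=RH(x)$ for all $x$, and $H(0)$ invertible (Assumption 1). The values $f(0)$, $G(0)$ and the bounds $L_f,L_G$ are known, and $G(0)\neq 0$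 (Assumption 2). The constant $\mu$: $\mu = 1$ if $\mathrm{rank}(G(0)) = m = n$; $\mu = \sqrt{2}$ if $\mathrm{rank}(G(0)) = \min(m,n)$ and $m \neq n$; $\mu = \frac{1 + \sqrt{5}}{2}$ if $\mathrm{rank}(G(0)) < \min(m,n)$. Velocity sets: for $(L_f+L_G)\|x\|\le\|G(0)^\dagger\|^{-1}$, let $\bar{\mathcal{V}}^{\mathcal{G}}_{x} = \mathbb{B}^{n}(f(0); \|G(0)^{\dagger}\|^{-1} - L_f\|x\| - L_G\|x\|) \cap \mathrm{Im}(G(0))$; let $\bar{\bar{\mathcal{V}}}^{\mathcal{G}}_x = \{f(0) + kd \mid \|d\| = 1,\ d\in \mathrm{Im}(R),\ 0 \leq k \leq K(d)\}$ with $K(d) = \frac{\|G(0)^\dagger\|^{-1} - L_G\|x\| - L_f\|x\|}{\|G(0)^\dagger d\|(\|G(0)^\dagger\|^{-1} - L_G\|x\|) + \mu\|G(0)^\dagger\| L_G\|x\|}$; and let $\hat{\mathcal{V}}^{\mathcal{G}}_x=\bar{\mathcal{V}}^{\mathcal{G}}_x\cup\bar{\bar{\mathcal{V}}}^{\mathcal{G}}_x$. Here $\mathcal{S}(x)$ is the finite set of boundary points of $\hat{\mathcal{V}}^{\mathcal{G}}_x$ along the left singular vectors of $G(0)$, i.e. the points $f(0)+t^*v$ for $v\in\{\pm\eta_1,\dots,\pm\eta_n\}$, where $t^*=\max\{t\ge0 \mid f(0)+tv\in\hat{\mathcal{V}}^{\mathcal{G}}_x\}$. $P(\mathcal{S}(x))$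 is the convex hull of $\mathcal{S}(x)$. Consistent systems: $\mathcal{D}_{con}$ is the set of all pairs $(\hat f,\hat G)$ consistent with Assumptions 1 and 2, i.e. such that $\hat f:\mathbb{R}^n\to\mathbb{R}^n$ is Lipschitz with constant $L_f$, $\hat G:\mathbb{R}^n\to\mathbb{R}^{n\times m}$ is Lipschitz with constant $L_G$, $\hat f(0)=f(0)$, $\hat G(0)=G(0)$, and there exist $R'\in\mathbb{R}^{n\times m}$, $r':\mathbb{R}^n\to\mathbb{R}^m$, $H':\mathbb{R}^n\to\mathbb{R}^{m\times m}$ with $\hat f=R'r'$, $\hat G=R'H'$ and $H'(0)$ invertible. Reachable sets: $\mathcal{R}^{\hat f,\hat G}(T,x_0)=\{\phi_u^{\hat f,\hat G}(t;x_0)\mid u:[0,T]\to\mathcal{U},\ t\in[0,T]\}$, where $\phi_u^{\hat f,\hat G}(\cdot;x_0)$ is the trajectory of $\dot x=\hat f(x)+\hat G(x)u$, $x(0)=x_0$, with control signal $u$. The guaranteed reachable set is $\mathcal{R}^{\mathcal{G}}(T,x_0)=\bigcap_{(\hat f,\hat G)\in\mathcal{D}_{con}}\mathcal{R}^{\hat f,\hat G}(T,x_0)$. The reachable set (at time $T$) of a differential inclusion or control system given on a domain is, analogously, the set of points $\phi(t)$, $t\in[0,T]$, where $\phi$ is a trajectory from $x_0$ that stays in the domain on $[0,t]$.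
   Formalization: The equality is false with Im(G(0)^T) in standard coordinates (e.g. G(0)=[0 1]); it is proved with "Vu in Im(G(0)^T)" instead of "u in Im(G(0)^T)", and as printed when Im(G(0)^T)=Im(Σ^T). The inclusion in the guaranteed reachable set is proved for both. *)

theory Defs
  imports "HOL-Analysis.Analysis"
begin

section \<open>Matrices\<close>

text \<open>An \<open>n \<times> m\<close> matrix is of type \<^typ>\<open>real^'m^'n\<close>. The library norm on this type is the
  Frobenius norm, whereas every matrix norm below is the one induced by the Euclidean norm.\<close>

abbreviation opnorm :: "real^'m^'n \<Rightarrow> real"
  where "opnorm M \<equiv> onorm ((*v) M)"

abbreviation Ran :: "real^'m^'n \<Rightarrow> (real^'n) set"
  where "Ran M \<equiv> range ((*v) M)"

definition norm1 :: "real^'m \<Rightarrow> real"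
  where "norm1 v = (\<Sum>j\<in>UNIV. \<bar>v $ j\<bar>)"

definition is_pinv :: "real^'m^'n \<Rightarrow> real^'n^'m \<Rightarrow> bool"
  where "is_pinv A X \<longleftrightarrow>
    A ** X ** A = A \<and> X ** A ** X = X \<and>
    transpose (A ** X) = A ** X \<and> transpose (X ** A) = X ** A"

definition pinv :: "real^'m^'n \<Rightarrow> real^'n^'m"
  where "pinv A = (THE X. is_pinv A X)"

text \<open>A finite index type carries no canonical order, so the numbering of coordinates is explicit:
  \<open>p\<close> numbers the rows \<open>1, \<dots>, n\<close> and \<open>q\<close> the columns \<open>1, \<dots>, m\<close>. The diagonal consists of the
  entries whose row number equals their column number.\<close>

definition numbering :: "('n::finite \<Rightarrow> nat) \<Rightarrow> bool"
  where "numbering p \<longleftrightarrow> bij_betw p UNIV {1..CARD('n)}"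

definition rect_diag :: "('n \<Rightarrow> nat) \<Rightarrow> ('m \<Rightarrow> nat) \<Rightarrow> ('n \<Rightarrow> real) \<Rightarrow> real^'m^'n"
  where "rect_diag p q d = (\<chi> i j. if p i = q j then d i else 0)"

text \<open>Values \<open>\<sigma> i\<close> with \<open>p i > m\<close> do not occur in \<open>\<Sigma>\<close>; requiring the inequalities for them as well
  is no restriction, as they can be taken to be zero.\<close>

definition is_svd ::
  "('n \<Rightarrow> nat) \<Rightarrow> ('m \<Rightarrow> nat) \<Rightarrow> real^'m^'n \<Rightarrow> real^'n^'n \<Rightarrow> real^'m^'n \<Rightarrow> real^'m^'m \<Rightarrow> bool"
  where "is_svd p q A U S V \<longleftrightarrow>
    orthogonal_matrix U \<and> orthogonal_matrix V \<and> A = U ** S ** transpose V \<and>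
    (\<exists>\<sigma>. S = rect_diag p q \<sigma> \<and> (\<forall>i. 0 \<le> \<sigma> i) \<and> (\<forall>i i'. p i \<le> p i' \<longrightarrow> \<sigma> i' \<le> \<sigma> i))"


section \<open>Trajectories and reachable sets\<close>

definition abs_continuous_on :: "real set \<Rightarrow> (real \<Rightarrow> 'a::real_normed_vector) \<Rightarrow> bool"
  where "abs_continuous_on I \<phi> \<longleftrightarrow>
    (\<forall>\<epsilon>>0. \<exists>\<delta>>0. \<forall>(N::nat) a b.
      (\<forall>k<N. a k \<le> b k \<and> {a k..b k} \<subseteq> I) \<and>
      disjoint_family_on (\<lambda>k. {a k<..<b k}) {..<N} \<and>
      (\<Sum>k<N. b k - a k) < \<delta>
      \<longrightarrow> (\<Sum>k<N. norm (\<phi> (b k) - \<phi> (a k))) < \<epsilon>)"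

text \<open>Trajectories on \<open>[0, t]\<close> are absolutely continuous and satisfy the inclusion or the equation
  almost everywhere; control signals are measurable.\<close>

definition solves_inclusion ::
  "(real^'n \<Rightarrow> (real^'n) set) \<Rightarrow> real^'n \<Rightarrow> real \<Rightarrow> (real \<Rightarrow> real^'n) \<Rightarrow> bool"
  where "solves_inclusion F x0 t \<phi> \<longleftrightarrow>
    abs_continuous_on {0..t} \<phi> \<and> \<phi> 0 = x0 \<and>
    (AE \<tau> in lebesgue_on {0..t}.
      \<exists>v\<in>F (\<phi> \<tau>). (\<phi> has_vector_derivative v) (at \<tau> within {0..t}))"

definition solves_control ::
  "(real^'n \<Rightarrow> real^'m \<Rightarrow> real^'n) \<Rightarrow> (real^'m) set \<Rightarrow> (real \<Rightarrow> real^'m) \<Rightarrow> real^'n \<Rightarrow> real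
    \<Rightarrow> (real \<Rightarrow> real^'n) \<Rightarrow> bool"
  where "solves_control F \<Omega> u x0 t \<phi> \<longleftrightarrow>
    u \<in> borel_measurable (lebesgue_on {0..t}) \<and> u ` {0..t} \<subseteq> \<Omega> \<and>
    abs_continuous_on {0..t} \<phi> \<and> \<phi> 0 = x0 \<and>
    (AE \<tau> in lebesgue_on {0..t}.
      (\<phi> has_vector_derivative F (\<phi> \<tau>) (u \<tau>)) (at \<tau> within {0..t}))"

definition reach ::
  "(real^'n \<Rightarrow> real^'m \<Rightarrow> real^'n) \<Rightarrow> (real^'m) set \<Rightarrow> real \<Rightarrow> real^'n \<Rightarrow> (real^'n) set"
  where "reach F \<Omega> T x0 = {\<phi> t | u \<phi> t. t \<in> {0..T} \<and> solves_control F \<Omega> u x0 T \<phi>}"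

text \<open>For dynamics given on a domain \<open>D\<close> only, a trajectory has to exist, and stay in \<open>D\<close>, just until
  the time \<open>t\<close> at which the point is reached.\<close>

definition reach_on ::
  "(real^'n) set \<Rightarrow> (real^'n \<Rightarrow> real^'m \<Rightarrow> real^'n) \<Rightarrow> (real^'m) set \<Rightarrow> real \<Rightarrow> real^'n
    \<Rightarrow> (real^'n) set"
  where "reach_on D F \<Omega> T x0 =
    {\<phi> t | u \<phi> t. t \<in> {0..T} \<and> solves_control F \<Omega> u x0 t \<phi> \<and> \<phi> ` {0..t} \<subseteq> D}"

definition reach_inclusion_on ::
  "(real^'n) set \<Rightarrow> (real^'n \<Rightarrow> (real^'n) set) \<Rightarrow> real \<Rightarrow> real^'n \<Rightarrow> (real^'n) set"
  where "reach_inclusion_on D F T x0 =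
    {\<phi> t | \<phi> t. t \<in> {0..T} \<and> solves_inclusion F x0 t \<phi> \<and> \<phi> ` {0..t} \<subseteq> D}"


section \<open>Consistent systems and the guaranteed reachable set\<close>

definition op_lipschitz :: "real \<Rightarrow> (real^'n \<Rightarrow> real^'m^'n) \<Rightarrow> bool"
  where "op_lipschitz L G \<longleftrightarrow> (\<forall>x y. opnorm (G x - G y) \<le> L * norm (x - y))"

definition factors ::
  "(real^'n \<Rightarrow> real^'n) \<Rightarrow> (real^'n \<Rightarrow> real^'m^'n) \<Rightarrow> real^'m^'n
    \<Rightarrow> (real^'n \<Rightarrow> real^'m) \<Rightarrow> (real^'n \<Rightarrow> real^'m^'m) \<Rightarrow> bool"
  where "factors f G R \<rho> H \<longleftrightarrow>
    (\<forall>x. f x = R *v \<rho> x) \<and> (\<forall>x. G x = R ** H x) \<and> invertible (H 0)"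

definition D_con ::
  "real \<Rightarrow> real \<Rightarrow> real^'n \<Rightarrow> real^'m^'n
    \<Rightarrow> ((real^'n \<Rightarrow> real^'n) \<times> (real^'n \<Rightarrow> real^'m^'n)) set"
  where "D_con Lf LG f0 G0 =
    {(f, G). Lf-lipschitz_on UNIV f \<and> op_lipschitz LG G \<and> f 0 = f0 \<and> G 0 = G0 \<and>
       (\<exists>R \<rho> H. factors f G R \<rho> H)}"

definition affine_system ::
  "(real^'n \<Rightarrow> real^'n) \<Rightarrow> (real^'n \<Rightarrow> real^'m^'n) \<Rightarrow> real^'n \<Rightarrow> real^'m \<Rightarrow> real^'n"
  where "affine_system f G x u = f x + G x *v u"

definition guaranteed_reach ::
  "real \<Rightarrow> real \<Rightarrow> real^'n \<Rightarrow> real^'m^'n \<Rightarrow> real \<Rightarrow> real^'n \<Rightarrow> (real^'n) set"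
  where "guaranteed_reach Lf LG f0 G0 T x0 =
    (\<Inter>(f, G)\<in>D_con Lf LG f0 G0. reach (affine_system f G) (cball 0 1) T x0)"


section \<open>Velocity sets\<close>

definition mu :: "real^'m^'n \<Rightarrow> real"
  where "mu (G0::real^'m^'n) =
    (if rank G0 = CARD('m) \<and> CARD('m) = CARD('n) then 1
     else if rank G0 = min CARD('m) CARD('n) then sqrt 2
     else (1 + sqrt 5) / 2)"

definition gap :: "real \<Rightarrow> real \<Rightarrow> real^'m^'n \<Rightarrow> real \<Rightarrow> real"
  where "gap Lf LG G0 s = inverse (opnorm (pinv G0)) - (LG + Lf) * s"

definition alpha :: "real \<Rightarrow> real^'m^'n \<Rightarrow> real \<Rightarrow> real"
  where "alpha LG G0 s = inverse (opnorm (pinv G0)) - LG * s"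

definition beta :: "real \<Rightarrow> real^'m^'n \<Rightarrow> real \<Rightarrow> real"
  where "beta LG G0 s = mu G0 * opnorm (pinv G0) * LG * s"

definition K_bound :: "real \<Rightarrow> real \<Rightarrow> real^'m^'n \<Rightarrow> real^'n \<Rightarrow> real^'n \<Rightarrow> real"
  where "K_bound Lf LG G0 x d =
    (inverse (opnorm (pinv G0)) - LG * norm x - Lf * norm x) /
    (norm (pinv G0 *v d) * (inverse (opnorm (pinv G0)) - LG * norm x)
       + mu G0 * opnorm (pinv G0) * LG * norm x)"

definition V_ball :: "real \<Rightarrow> real \<Rightarrow> real^'n \<Rightarrow> real^'m^'n \<Rightarrow> real^'n \<Rightarrow> (real^'n) set"
  where "V_ball Lf LG f0 G0 x =
    cball f0 (inverse (opnorm (pinv G0)) - Lf * norm x - LG * norm x) \<inter> Ran G0"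

definition V_dir ::
  "real \<Rightarrow> real \<Rightarrow> real^'n \<Rightarrow> real^'m^'n \<Rightarrow> real^'m^'n \<Rightarrow> real^'n \<Rightarrow> (real^'n) set"
  where "V_dir Lf LG f0 G0 R x =
    {f0 + k *\<^sub>R d | k d. norm d = 1 \<and> d \<in> Ran R \<and> 0 \<le> k \<and> k \<le> K_bound Lf LG G0 x d}"

definition V_hat ::
  "real \<Rightarrow> real \<Rightarrow> real^'n \<Rightarrow> real^'m^'n \<Rightarrow> real^'m^'n \<Rightarrow> real^'n \<Rightarrow> (real^'n) set"
  where "V_hat Lf LG f0 G0 R x = V_ball Lf LG f0 G0 x \<union> V_dir Lf LG f0 G0 R x"

definition S_set ::
  "real \<Rightarrow> real \<Rightarrow> real^'n \<Rightarrow> real^'m^'n \<Rightarrow> real^'m^'n \<Rightarrow> real^'n^'n \<Rightarrow> real^'n \<Rightarrow> (real^'n) set"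
  where "S_set Lf LG f0 G0 R U x =
    {f0 + (GREATEST t. 0 \<le> t \<and> f0 + t *\<^sub>R v \<in> V_hat Lf LG f0 G0 R x) *\<^sub>R v | v.
       \<exists>i. v = column i U \<or> v = - column i U}"

definition lam ::
  "real \<Rightarrow> real \<Rightarrow> real^'m^'n \<Rightarrow> ('n \<Rightarrow> nat) \<Rightarrow> real^'n^'n \<Rightarrow> real \<Rightarrow> 'n \<Rightarrow> real"
  where "lam Lf LG G0 p U s i =
    (if p i \<le> rank G0
     then Max {gap Lf LG G0 s /
                 (alpha LG G0 s * norm (pinv G0 *v column i U) + beta LG G0 s),
               gap Lf LG G0 s, 0}
     else 0)"

definition Lam ::
  "real \<Rightarrow> real \<Rightarrow> real^'m^'n \<Rightarrow> ('n \<Rightarrow> nat) \<Rightarrow> ('m \<Rightarrow> nat) \<Rightarrow> real^'n^'n \<Rightarrow> real \<Rightarrow> real^'m^'n"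
  where "Lam Lf LG G0 p q U s = rect_diag p q (lam Lf LG G0 p U s)"

definition svd_system ::
  "real \<Rightarrow> real \<Rightarrow> real^'n \<Rightarrow> real^'m^'n \<Rightarrow> ('n \<Rightarrow> nat) \<Rightarrow> ('m \<Rightarrow> nat) \<Rightarrow> real^'n^'n
    \<Rightarrow> real^'n \<Rightarrow> real^'m \<Rightarrow> real^'n"
  where "svd_system Lf LG f0 G0 p q U x u = f0 + (U ** Lam Lf LG G0 p q U (norm x)) *v u"

definition state_domain :: "real \<Rightarrow> real \<Rightarrow> real^'m^'n \<Rightarrow> (real^'n) set"
  where "state_domain Lf LG G0 = {x. norm x \<le> inverse (opnorm (pinv G0)) / (Lf + LG)}"

text \<open>The diagonal matrix \<open>\<Lambda>\<close> takes the place of \<open>\<Sigma>\<close> in \<open>U \<Sigma> V\<^sup>T\<close>, hence it acts on the coordinates of an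
  input with respect to the right singular vectors. Accordingly, \<open>u\<close> in \<open>svd_controls\<close> is the
  coordinate vector of the element \<open>V u\<close> of \<open>Ran (G0\<^sup>T)\<close>. In \<open>std_controls\<close> the subspace \<open>Ran (G0\<^sup>T)\<close> is
  taken in the standard coordinates instead. If \<open>G0\<close> has full column rank, both are the whole unit
  ball of the 1-norm. In general they differ: for \<open>G0 = [0 1]\<close> the first coordinate of \<open>u\<close>, the only
  one that \<open>\<Lambda>\<close> sees, ranges over \<open>[-1, 1]\<close> in the former but is \<open>0\<close> throughout the latter.\<close>

definition svd_controls :: "real^'m^'n \<Rightarrow> real^'m^'m \<Rightarrow> (real^'m) set"
  where "svd_controls G0 V = {u. norm1 u \<le> 1} \<inter> {u. V *v u \<in> Ran (transpose G0)}"

definition std_controls :: "real^'m^'n \<Rightarrow> (real^'m) set"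
  where "std_controls G0 = {u. norm1 u \<le> 1} \<inter> Ran (transpose G0)"

end

theory Submission
  imports Defs
begin

text \<open>
  Write \<open>A = G 0\<close>, \<open>X\<close> for its pseudoinverse and \<open>\<alpha> = 1/\<parallel>X\<parallel> - L\<^sub>G \<parallel>x\<parallel>\<close>.

  Equality of the two reachable sets. For \<open>x\<close> in the domain, the ray from \<open>f 0\<close> along a left singular
  vector \<open>\<plusminus>\<eta>\<^sub>i\<close> leaves the velocity set exactly at distance \<open>\<lambda>\<^sub>i(\<parallel>x\<parallel>)\<close> (\<open>V_hat_ray_iff\<close>): if
  \<open>i \<le> r\<close>, then \<open>\<eta>\<^sub>i\<close> lies in \<open>Ran A\<close> and both the ball and the directional bound count, and otherwise
  only \<open>f 0\<close> itself is left. So the hull of these points is the affine image of a cross-polytope,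
  namely \<open>f 0 + U \<Lambda> u\<close> for \<open>u\<close> in the unit ball of the 1-norm supported on the first \<open>r\<close> coordinates
  (\<open>hull_eq\<close>). The inclusion and the control system therefore admit the same velocities. To pass from a
  trajectory of the inclusion to a measurable control, the derivative is written as a limit of
  difference quotients and the control is read off from it by dividing its coordinates with respect
  to the columns of \<open>U\<close> by the \<open>\<lambda>\<^sub>i\<close>.

  Inclusion in the guaranteed reachable set. Let \<open>(f', G')\<close> be consistent and \<open>B = G' x\<close>. The
  factorization through a common left factor with \<open>H 0\<close> invertible forces \<open>f' x\<close> and \<open>Ran B\<close> into
  \<open>Ran A\<close>, while \<open>\<parallel>B - A\<parallel> \<le> L\<^sub>G \<parallel>x\<parallel> < 1/\<parallel>X\<parallel>\<close>. As \<open>\<parallel>A\<^sup>T y\<parallel> \<ge> \<parallel>y\<parallel>/\<parallel>X\<parallel>\<close> on \<open>Ran A\<close>, it follows that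
  \<open>\<parallel>B\<^sup>T y\<parallel> \<ge> \<alpha> \<parallel>y\<parallel>\<close> there, so \<open>B B\<^sup>T\<close> is bijective on \<open>Ran A\<close> and every \<open>z \<in> Ran A\<close> has a solution
  \<open>u\<close> of \<open>B u = z\<close> with \<open>\<parallel>u\<parallel> \<le> \<parallel>z\<parallel>/\<alpha>\<close>. This settles the velocities in the ball. For those in
  a direction \<open>d\<close>, the solution \<open>a = X d\<close> of the unperturbed equation is corrected by a solution of
  \<open>B e = (A - B) a\<close>; this costs only \<open>\<parallel>e\<parallel> \<le> \<parallel>X\<parallel> L\<^sub>G \<parallel>x\<parallel>/\<alpha>\<close>, so \<open>\<alpha> \<parallel>e\<parallel>\<close> is at most the
  perturbation term in the denominator of \<open>K(d)\<close>, because \<open>\<mu> \<ge> 1\<close> (\<open>directional_velocity\<close>). The velocities that a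
  consistent system can realize form a convex set, so together with the velocity set it contains the
  hull (\<open>system_velocity_realizable\<close>).

  It remains to turn this pointwise statement into one control signal on the whole of \<open>[0, T]\<close>. The
  control of least norm is given by an explicit formula, which makes it measurable along the
  trajectory. After the time at which the point has been reached, the control is set to zero and
  the trajectory is continued by solving \<open>y' = f' y\<close> (\<open>solves_control_extend\<close>).
\<close>


section \<open>The Moore-Penrose pseudoinverse\<close>

(* Keeps products with transposed matrices in the form in which the adjoint identity applies. *)
declare transpose_matrix_vector [simp del] vector_transpose_matrix [simp del]

lemma is_pinv_unique:
  fixes A :: "real^'m^'n"
  assumes "is_pinv A X" and "is_pinv A Y"
  shows "X = Y"
proof -
  have X: "A ** X ** A = A" "X ** A ** X = X" "transpose (A ** X) = A ** X"
      "transpose (X ** A) = X ** A"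
    and Y: "A ** Y ** A = A" "Y ** A ** Y = Y" "transpose (A ** Y) = A ** Y"
      "transpose (Y ** A) = Y ** A"
    using assms unfolding is_pinv_def by auto
  have "A ** X = transpose (A ** X)"
    using X(3) by simp
  also have "\<dots> = transpose ((A ** Y) ** (A ** X))"
    using Y(1) by (simp add: matrix_mul_assoc)
  also have "\<dots> = (A ** X) ** (A ** Y)"
    using X(3) Y(3) by (simp add: matrix_transpose_mul)
  also have "\<dots> = A ** Y"
    using X(1) by (simp add: matrix_mul_assoc)
  finally have AX: "A ** X = A ** Y" .
  have "X ** A = transpose (X ** A)"
    using X(4) by simp
  also have "\<dots> = transpose ((X ** A) ** (Y ** A))"
    using Y(1) by (simp add: matrix_mul_assoc[symmetric])
  also have "\<dots> = (Y ** A) ** (X ** A)"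
    using X(4) Y(4) by (simp add: matrix_transpose_mul)
  also have "\<dots> = Y ** A"
    using X(1) by (simp add: matrix_mul_assoc[symmetric])
  finally have XA: "X ** A = Y ** A" .
  have "X = X ** (A ** X)"
    using X(2) by (simp add: matrix_mul_assoc)
  also have "\<dots> = (Y ** A) ** Y"
    using AX XA by (simp add: matrix_mul_assoc)
  also have "\<dots> = Y"
    using Y(2) by simp
  finally show ?thesis .
qed

lemma pinv_eqI: "is_pinv A X \<Longrightarrow> pinv A = X"
  unfolding pinv_def by (rule the_equality) (auto intro: is_pinv_unique)

lemma Ran_iff_pinv:
  fixes A :: "real^'m^'n"
  assumes "is_pinv A X"
  shows "y \<in> Ran A \<longleftrightarrow> A *v (X *v y) = y"
proof
  assume "y \<in> Ran A"
  then obtain u where "y = A *v u" by blast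
  then show "A *v (X *v y) = y"
    using assms by (simp add: is_pinv_def matrix_vector_mul_assoc matrix_mul_assoc)
qed (metis rangeI)

text \<open>The four Penrose equations are invariant under transposition. In this way statements about ranges
  of columns yield those about ranges of rows.\<close>

lemma is_pinv_transpose:
  assumes "is_pinv A X"
  shows "is_pinv (transpose A) (transpose X)"
proof -
  have "transpose A ** transpose X = X ** A" "transpose X ** transpose A = A ** X"
    using assms by (simp_all add: is_pinv_def flip: matrix_transpose_mul)
  moreover have "transpose A ** transpose X ** transpose A = transpose (A ** X ** A)"
      "transpose X ** transpose A ** transpose X = transpose (X ** A ** X)"
    by (simp_all add: matrix_transpose_mul matrix_mul_assoc)
  ultimately show ?thesis
    using assms by (simp add: is_pinv_def)
qed

lemma Ran_transpose_iff_pinv: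
  fixes A :: "real^'m^'n"
  assumes "is_pinv A X"
  shows "w \<in> Ran (transpose A) \<longleftrightarrow> X *v (A *v w) = w"
proof -
  have "transpose A ** transpose X = X ** A"
    using assms unfolding is_pinv_def by (metis matrix_transpose_mul)
  then show ?thesis
    using Ran_iff_pinv[OF is_pinv_transpose[OF assms], of w]
    by (simp only: matrix_vector_mul_assoc)
qed

lemma norm_mult_le_opnorm: "norm ((M::real^'m^'n) *v v) \<le> opnorm M * norm v"
  by (rule onorm) (rule matrix_vector_mul_bounded_linear)

lemma inner_transpose: "(transpose (M::real^'m^'n) *v w) \<bullet> v = w \<bullet> (M *v v)"
  by (metis dot_lmul_matrix transpose_matrix_vector)

text \<open>The reason is \<open>\<parallel>M\<^sup>T w\<parallel>\<^sup>2 = \<langle>w, M M\<^sup>T w\<rangle>\<close>.\<close>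

lemma norm_transpose_mult_le_opnorm:
  "norm (transpose (M::real^'m^'n) *v w) \<le> opnorm M * norm w"
proof -
  let ?v = "transpose M *v w"
  have "norm ?v * norm ?v = w \<bullet> (M *v ?v)"
    by (metis inner_transpose dot_square_norm power2_eq_square)
  also have "\<dots> \<le> norm w * (opnorm M * norm ?v)"
    by (meson mult_left_mono norm_cauchy_schwarz norm_ge_zero norm_mult_le_opnorm order_trans)
  finally have "norm ?v * norm ?v \<le> (opnorm M * norm w) * norm ?v"
    by (simp add: mult_ac)
  then show ?thesis
    by (cases "norm ?v = 0")
      (simp_all add: onorm_pos_le matrix_vector_mul_bounded_linear)
qed

text \<open>The inverse of \<open>\<parallel>X\<parallel>\<close> is the least nonzero singular value of \<open>A\<close>, and this is the form in which it
  enters all estimates. The reason is that \<open>X\<^sup>T A\<^sup>T = (A X)\<^sup>T = A X\<close> is the orthogonal projection onto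
  \<open>Ran A\<close>.\<close>

lemma norm_le_transpose_on_Ran:
  fixes A :: "real^'m^'n"
  assumes "is_pinv A X" and "c \<in> Ran A"
  shows "norm c \<le> opnorm X * norm (transpose A *v c)"
proof -
  have "transpose X *v (transpose A *v c) = transpose (A ** X) *v c"
    by (simp add: matrix_vector_mul_assoc matrix_transpose_mul)
  also have "\<dots> = c"
    using assms Ran_iff_pinv[OF assms(1)] by (simp add: is_pinv_def matrix_vector_mul_assoc)
  finally show ?thesis
    by (metis norm_transpose_mult_le_opnorm)
qed

lemma opnorm_pinv_pos:
  assumes "is_pinv A X" and "A \<noteq> 0"
  shows "opnorm X > 0"
proof -
  have "X \<noteq> 0"
    using assms by (auto simp: is_pinv_def)
  then have "\<exists>v. X *v v \<noteq> 0"
    by (metis matrix_eq matrix_vector_mult_0)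
  then show ?thesis
    by (simp add: onorm_pos_lt matrix_vector_mul_bounded_linear)
qed

section \<open>Singular value decompositions\<close>

text \<open>In what follows diagonal entries are functions of the number of a row or column instead of its
  index. Then the same function \<open>D\<close> describes a diagonal matrix, its transpose and all products,
  although rows and columns are indexed by different types.\<close>

lemma transpose_rect_diag:
  "transpose (rect_diag p q (\<lambda>i. D (p i))) = rect_diag q p (\<lambda>j. D (q j))"
  by (auto simp: rect_diag_def transpose_def vec_eq_iff)

lemma rect_diag_mult:
  assumes "inj q"
  shows "rect_diag p q (\<lambda>i. D (p i)) ** rect_diag q s (\<lambda>j. E (q j))
    = rect_diag p s (\<lambda>i. if p i \<in> range q then D (p i) * E (p i) else 0)"
proof -
  have "(\<Sum>k\<in>UNIV. (if p i = q k then D (p i) else 0) * (if q k = s j then E (q k) else 0))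
    = (if p i = s j \<and> p i \<in> range q then D (p i) * E (p i) else 0)" for i j
  proof (cases "p i \<in> range q")
    case True
    then obtain k0 where k0: "p i = q k0" by blast
    have "(\<Sum>k\<in>UNIV. (if p i = q k then D (p i) else 0) * (if q k = s j then E (q k) else 0))
      = (\<Sum>k\<in>UNIV. if k = k0 then (if p i = s j then D (p i) * E (p i) else 0) else 0)"
      using inj_eq[OF assms] by (intro sum.cong refl) (auto simp: k0)
    then show ?thesis using True by simp
  next
    case False
    then have "p i \<noteq> q k" for k
      by (metis rangeI)
    with False show ?thesis by simp
  qed
  then show ?thesis
    by (auto simp: rect_diag_def matrix_matrix_mult_def vec_eq_iff)
qed

lemma rect_diag_cong:
  "(\<And>i j. p i = q j \<Longrightarrow> d i = e i) \<Longrightarrow> rect_diag p q d = rect_diag p q e"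
  by (auto simp: rect_diag_def vec_eq_iff)

lemma rect_diag_mult_vec:
  assumes "inj q"
  shows "(rect_diag p q d *v u) $ i = (\<Sum>j\<in>UNIV. if q j = p i then d i * u $ j else 0)"
  by (auto simp: rect_diag_def matrix_vector_mult_def intro!: sum.cong)

lemma square_diag_mult_vec:
  assumes "inj p"
  shows "rect_diag p p d *v u = (\<chi> i. d i * u $ i)"
proof -
  have "(\<Sum>j\<in>UNIV. if p j = p i then d i * u $ j else 0) = d i * u $ i" for i
    using assms by (simp add: inj_eq)
  then show ?thesis
    by (simp add: vec_eq_iff rect_diag_mult_vec[OF assms])
qed

lemma downward_closed_nat_set:
  assumes "finite (A::nat set)" and "\<And>k. k \<in> A \<Longrightarrow> k \<ge> 1"
    and "\<And>k l. k \<in> A \<Longrightarrow> 1 \<le> l \<Longrightarrow> l \<le> k \<Longrightarrow> l \<in> A"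
  shows "A = {1..card A}"
proof (cases "A = {}")
  case False
  define m where "m = Max A"
  have "m \<in> A" and "\<And>k. k \<in> A \<Longrightarrow> k \<le> m"
    using assms(1) False by (auto simp: m_def)
  then have "k \<in> A \<longleftrightarrow> 1 \<le> k \<and> k \<le> m" for k
    using assms(2)[of k] assms(3)[of m k] by blast
  then have "A = {1..m}"
    by (intro set_eqI) simp
  then show ?thesis by simp
qed simp

text \<open>\<open>D k\<close> is the \<open>k\<close>-th singular value.\<close>

locale singular_value_decomposition =
  fixes A :: "real^'m^'n" and U :: "real^'n^'n" and V :: "real^'m^'m"
    and p :: "'n \<Rightarrow> nat" and q :: "'m \<Rightarrow> nat" and D :: "nat \<Rightarrow> real"
  assumes p: "numbering p" and q: "numbering q"
    and U: "orthogonal_matrix U" and V: "orthogonal_matrix V"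
    and A_eq: "A = U ** rect_diag p q (\<lambda>i. D (p i)) ** transpose V"
    and D_nonneg: "0 \<le> D (p i)"
    and D_antimono: "p i \<le> p i' \<Longrightarrow> D (p i') \<le> D (p i)"
begin

abbreviation S :: "real^'m^'n"
  where "S \<equiv> rect_diag p q (\<lambda>i. D (p i))"

lemma inj_p: "inj p" and inj_q: "inj q"
  and range_p: "range p = {1..CARD('n)}" and range_q: "range q = {1..CARD('m)}"
  using p q unfolding numbering_def bij_betw_def by auto

lemma U_left: "transpose U ** U = mat 1" and U_right: "U ** transpose U = mat 1"
  and V_left: "transpose V ** V = mat 1"
  using U V by (auto simp: orthogonal_matrix_def)

text \<open>The numbers of the nonzero entries on the diagonal. That they are \<open>1, \<dots>, r\<close> can be seen only
  after the rank has been computed from them.\<close>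

definition active :: "nat set"
  where "active = {k \<in> range p \<inter> range q. D k \<noteq> 0}"

definition Sinv :: "real^'n^'m"
  where "Sinv = rect_diag q p (\<lambda>j. inverse (D (q j)))"

lemma S_Sinv: "S ** Sinv = rect_diag p p (\<lambda>i. if p i \<in> active then 1 else 0)"
  unfolding Sinv_def rect_diag_mult[OF inj_q, of p D p "\<lambda>k. inverse (D k)"]
  by (rule rect_diag_cong) (auto simp: active_def)

lemma Sinv_S: "Sinv ** S = rect_diag q q (\<lambda>j. if q j \<in> active then 1 else 0)"
  unfolding Sinv_def rect_diag_mult[OF inj_p, of q "\<lambda>k. inverse (D k)" q D]
  by (rule rect_diag_cong) (auto simp: active_def)

lemma S_Sinv_S: "S ** Sinv ** S = S"
proof -
  define d :: "nat \<Rightarrow> real" where "d k = (if k \<in> active then 1 else 0)" for k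
  have "S ** Sinv = rect_diag p p (\<lambda>i. d (p i))"
    unfolding S_Sinv d_def by simp
  then have "S ** Sinv ** S = rect_diag p p (\<lambda>i. d (p i)) ** rect_diag p q (\<lambda>i. D (p i))"
    by simp
  also have "\<dots> = rect_diag p q (\<lambda>i. D (p i))"
    unfolding rect_diag_mult[OF inj_p, of p d q D]
    by (rule rect_diag_cong) (auto simp: active_def d_def, metis rangeI)
  finally show ?thesis .
qed

lemma Sinv_S_Sinv: "Sinv ** S ** Sinv = Sinv"
proof -
  define d :: "nat \<Rightarrow> real" where "d k = (if k \<in> active then 1 else 0)" for k
  have "Sinv ** S = rect_diag q q (\<lambda>j. d (q j))"
    unfolding Sinv_S d_def by simp
  then have "Sinv ** S ** Sinv = rect_diag q q (\<lambda>j. d (q j)) ** rect_diag q p (\<lambda>j. inverse (D (q j)))"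
    by (simp add: Sinv_def)
  also have "\<dots> = Sinv"
    unfolding rect_diag_mult[OF inj_q, of q d p "\<lambda>k. inverse (D k)"] Sinv_def
    by (rule rect_diag_cong) (auto simp: active_def d_def, metis rangeI)
  finally show ?thesis .
qed

definition X :: "real^'n^'m"
  where "X = V ** Sinv ** transpose U"

lemma A_X: "A ** X = U ** (S ** Sinv) ** transpose U"
proof -
  have "A ** X = U ** S ** (transpose V ** V) ** Sinv ** transpose U"
    by (simp only: A_eq X_def matrix_mul_assoc)
  then show ?thesis
    by (simp add: V_left matrix_mul_assoc)
qed

lemma X_A: "X ** A = V ** (Sinv ** S) ** transpose V"
proof -
  have "X ** A = V ** Sinv ** (transpose U ** U) ** S ** transpose V"
    by (simp only: A_eq X_def matrix_mul_assoc)
  then show ?thesis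
    by (simp add: U_left matrix_mul_assoc)
qed

text \<open>The pseudoinverse of a diagonal matrix inverts its nonzero entries, and multiplication by
  orthogonal matrices preserves the Penrose equations.\<close>

lemma is_pinv_X: "is_pinv A X"
proof -
  have "A ** X ** A = U ** S ** Sinv ** (transpose U ** U) ** S ** transpose V"
    unfolding A_X by (simp only: A_eq matrix_mul_assoc)
  also have "\<dots> = U ** (S ** Sinv ** S) ** transpose V"
    by (simp add: U_left matrix_mul_assoc)
  also have "\<dots> = A"
    by (simp add: S_Sinv_S A_eq)
  finally have "A ** X ** A = A" .
  moreover have "X ** A ** X = X"
  proof -
    have "X ** A ** X = V ** Sinv ** S ** (transpose V ** V) ** Sinv ** transpose U"
      unfolding X_A by (simp only: X_def matrix_mul_assoc)
    also have "\<dots> = V ** (Sinv ** S ** Sinv) ** transpose U"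
      by (simp add: V_left matrix_mul_assoc)
    finally show ?thesis
      by (simp add: Sinv_S_Sinv X_def)
  qed
  moreover have "transpose (A ** X) = A ** X"
  proof -
    have "transpose (S ** Sinv) = S ** Sinv"
      unfolding S_Sinv using transpose_rect_diag[of p p "\<lambda>k. if k \<in> active then 1 else 0"] by simp
    then show ?thesis
      unfolding A_X by (simp add: matrix_transpose_mul matrix_mul_assoc)
  qed
  moreover have "transpose (X ** A) = X ** A"
  proof -
    have "transpose (Sinv ** S) = Sinv ** S"
      unfolding Sinv_S using transpose_rect_diag[of q q "\<lambda>k. if k \<in> active then 1 else 0"] by simp
    then show ?thesis
      unfolding X_A by (simp add: matrix_transpose_mul matrix_mul_assoc)
  qed
  ultimately show ?thesis
    by (simp add: is_pinv_def)
qed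

lemma pinv_A: "pinv A = X"
  by (rule pinv_eqI[OF is_pinv_X])

lemma transpose_U_mult_column: "transpose U *v column i U = axis i 1"
proof -
  have "transpose U *v column i U = transpose U *v (U *v axis i 1)"
    by (simp only: matrix_vector_mult_basis)
  then show ?thesis
    by (simp add: matrix_vector_mul_assoc U_left)
qed

lemma A_X_mult_column: "A *v (X *v column i U) = (if p i \<in> active then column i U else 0)"
proof -
  have "rect_diag p p (\<lambda>i. if p i \<in> active then 1 else 0) *v axis i (1::real)
    = (if p i \<in> active then axis i 1 else 0)"
    by (auto simp: square_diag_mult_vec[OF inj_p] vec_eq_iff axis_def)
  then have "A ** X *v column i U = U *v (if p i \<in> active then axis i 1 else 0)"
    unfolding A_X S_Sinv matrix_vector_mul_assoc[symmetric] transpose_U_mult_column by simp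
  then show ?thesis
    by (simp add: matrix_vector_mul_assoc matrix_vector_mult_basis split: if_splits)
qed

lemma column_U_nonzero: "column i U \<noteq> 0"
proof
  assume "column i U = 0"
  then have "axis i (1::real) = 0"
    using transpose_U_mult_column[of i] by simp
  then show False by (simp add: axis_eq_0_iff)
qed

lemma column_in_Ran_iff: "column i U \<in> Ran A \<longleftrightarrow> p i \<in> active"
  using Ran_iff_pinv[OF is_pinv_X] column_U_nonzero by (simp add: A_X_mult_column)

text \<open>\<open>X A\<close> is the projection onto \<open>Ran A\<^sup>T\<close>, and in the coordinates given by \<open>V\<close> it deletes the inactive
  entries.\<close>

lemma coordinates_in_Ran_transpose_iff:
  "V *v u \<in> Ran (transpose A) \<longleftrightarrow> (\<forall>j. q j \<notin> active \<longrightarrow> u $ j = 0)"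
proof -
  have "X *v (A *v (V *v u)) = V ** (Sinv ** S) ** (transpose V ** V) *v u"
    by (simp add: matrix_vector_mul_assoc X_A matrix_mul_assoc)
  also have "\<dots> = V *v (Sinv ** S *v u)"
    by (simp add: V_left matrix_vector_mul_assoc)
  finally have "V *v u \<in> Ran (transpose A) \<longleftrightarrow> V *v (Sinv ** S *v u) = V *v u"
    unfolding Ran_transpose_iff_pinv[OF is_pinv_X] by simp
  also have "\<dots> \<longleftrightarrow> Sinv ** S *v u = u"
    by (metis V_left matrix_vector_mul_assoc matrix_vector_mul_lid)
  also have "\<dots> \<longleftrightarrow> (\<forall>j. q j \<notin> active \<longrightarrow> u $ j = 0)"
    by (auto simp: Sinv_S square_diag_mult_vec[OF inj_q] vec_eq_iff)
  finally show ?thesis .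
qed

text \<open>The projection \<open>A X\<close> keeps the active columns of \<open>U\<close> and annihilates the others, so the active columns
  form an orthonormal basis of \<open>Ran A\<close>.\<close>

lemma rank_eq_card_active: "rank A = card active"
proof -
  let ?E = "(\<lambda>i. column i U) ` {i. p i \<in> active}"
  have col: "column i U = U *v axis i 1" for i
    by (simp add: matrix_vector_mult_basis)
  have inj: "inj_on (\<lambda>i. column i U) UNIV"
    by (rule injI) (metis axis_eq_axis transpose_U_mult_column zero_neq_one)
  have "Ran A = span ?E"
  proof (intro equalityI subsetI)
    fix y assume "y \<in> Ran A"
    then have "y = A *v (X *v (U *v (transpose U *v y)))"
      using Ran_iff_pinv[OF is_pinv_X] by (simp add: U_right matrix_vector_mul_assoc)
    also have "U *v (transpose U *v y) = (\<Sum>i\<in>UNIV. (transpose U *v y) $ i *\<^sub>R column i U)"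
      by (simp add: matrix_mult_sum scalar_mult_eq_scaleR)
    also have "A *v (X *v \<dots>) = (\<Sum>i\<in>UNIV. (transpose U *v y) $ i *\<^sub>R (A *v (X *v column i U)))"
      by (simp add: linear_sum[OF matrix_vector_mul_linear] matrix_vector_mult_scaleR)
    also have "\<dots> \<in> span ?E"
      by (intro span_sum span_scale) (auto simp: A_X_mult_column intro: span_base span_zero)
    finally show "y \<in> span ?E" .
  next
    have "?E \<subseteq> Ran A" using column_in_Ran_iff by auto
    moreover have "subspace (Ran A)"
      by (intro linear_subspace_image) auto
    ultimately show "y \<in> Ran A" if "y \<in> span ?E" for y
      using that span_minimal by blast
  qed
  moreover have "independent ?E"
  proof (rule pairwise_orthogonal_independent)
    show "pairwise orthogonal ?E"
    proof (rule pairwiseI)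
      fix v w assume "v \<in> ?E" "w \<in> ?E" "v \<noteq> w"
      then obtain i j where "v = column i U" "w = column j U" "i \<noteq> j" by blast
      then show "orthogonal v w"
        using U by (simp add: orthogonal_matrix_orthonormal_columns)
    qed
    show "0 \<notin> ?E" using column_U_nonzero by (metis (no_types, lifting) imageE)
  qed
  ultimately have "rank A = card ?E"
    by (simp add: rank_dim_range dim_vec_eq dim_eq_card_independent)
  also have "\<dots> = card {i. p i \<in> active}"
    using inj by (intro card_image) (auto simp: inj_on_def)
  also have "\<dots> = card (p ` {i. p i \<in> active})"
    using inj_p by (intro card_image[symmetric]) (auto simp: inj_on_def)
  also have "p ` {i. p i \<in> active} = active"
    by (auto simp: active_def)
  finally show ?thesis .
qed

text \<open>As the singular values are decreasing, the active numbers form an initial segment.\<close>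

lemma active_eq: "active = {1..rank A}"
  unfolding rank_eq_card_active
proof (rule downward_closed_nat_set)
  show "finite active" unfolding active_def range_p by simp
  show "k \<in> active \<Longrightarrow> k \<ge> 1" for k unfolding active_def range_p by simp
  fix k l assume k: "k \<in> active" and l: "1 \<le> l" "l \<le> k"
  from k l have "l \<in> range p \<inter> range q" unfolding active_def range_p range_q by auto
  moreover obtain i i' where "k = p i" "l = p i'"
    using k calculation by (auto simp: active_def)
  ultimately show "l \<in> active"
    using k l D_antimono[of i' i] D_nonneg[of i] D_nonneg[of i'] by (auto simp: active_def)
qed

lemma row_active_iff: "p i \<in> active \<longleftrightarrow> p i \<le> rank A"
  using range_p by (force simp: active_eq)

end

section \<open>Perturbations that preserve the range\<close>

text \<open>Solving a linear system by Cramer's rule makes the solution a quotient of polynomials in the data,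
  which gives measurability in parameters at once.\<close>

definition cramer_solution :: "real^'n^'n \<Rightarrow> real^'n \<Rightarrow> real^'n"
  where "cramer_solution M z =
    (\<chi> k. det (\<chi> i j. if j = k then z $ i else M $ i $ j) / det M)"

text \<open>The solution of least norm of \<open>B u = z\<close> is \<open>B\<^sup>T y\<close> with \<open>B B\<^sup>T y = z\<close>. The matrix \<open>B B\<^sup>T\<close> is singular in
  general. Adding the projection \<open>1 - A X\<close> onto the orthogonal complement of \<open>Ran A\<close> makes it
  invertible without changing the solution for \<open>z \<in> Ran A\<close>.\<close>

definition least_norm_solution ::
  "real^'m^'n \<Rightarrow> real^'n^'m \<Rightarrow> real^'m^'n \<Rightarrow> real^'n \<Rightarrow> real^'m"
  where "least_norm_solution A X B z =
    transpose B *v cramer_solution (B ** transpose B + (mat 1 - A ** X)) z"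

locale range_preserving_perturbation =
  fixes A B :: "real^'m^'n" and X :: "real^'n^'m" and \<epsilon> :: real
  assumes pinv: "is_pinv A X" and Ran_le: "Ran B \<subseteq> Ran A"
    and close: "opnorm (B - A) \<le> \<epsilon>" and small: "\<epsilon> < inverse (opnorm X)"
begin

text \<open>A lower bound for the least nonzero singular value of \<open>B\<close>, as in Weyl's inequality.\<close>

definition margin :: real
  where "margin = inverse (opnorm X) - \<epsilon>"

lemma margin_pos: "margin > 0"
  using small by (simp add: margin_def)

lemma eps_nonneg: "0 \<le> \<epsilon>"
  using close onorm_pos_le[OF matrix_vector_mul_bounded_linear, of "B - A"] by linarith

lemma opnorm_X_pos: "opnorm X > 0"
  using small eps_nonneg by (meson inverse_positive_iff_positive le_less_trans)

lemma norm_diff_le: "norm ((B - A) *v v) \<le> \<epsilon> * norm v"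
  using norm_mult_le_opnorm[of "B - A" v] mult_right_mono[OF close, of "norm v"] by simp

lemma norm_transpose_diff_le: "norm (transpose (B - A) *v v) \<le> \<epsilon> * norm v"
  using norm_transpose_mult_le_opnorm[of "B - A" v] mult_right_mono[OF close, of "norm v"] by simp

lemma margin_le_transpose:
  assumes "y \<in> Ran A"
  shows "margin * norm y \<le> norm (transpose B *v y)"
proof -
  have "transpose A *v y = transpose B *v y - transpose (B - A) *v y"
    by (simp add: transpose_def matrix_vector_mult_def vec_eq_iff algebra_simps sum_subtractf)
  then have "norm (transpose A *v y) \<le> norm (transpose B *v y) + \<epsilon> * norm y"
    using norm_triangle_ineq4[of "transpose B *v y" "transpose (B - A) *v y"]
      norm_transpose_diff_le[of y] by simp
  moreover have "inverse (opnorm X) * norm y \<le> norm (transpose A *v y)"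
    using norm_le_transpose_on_Ran[OF pinv assms] opnorm_X_pos by (simp add: field_simps)
  ultimately show ?thesis
    by (simp add: margin_def algebra_simps)
qed

text \<open>\<open>B B\<^sup>T y\<close> lies in \<open>Ran A\<close> and \<open>y - A X y\<close> is orthogonal to it, so the two summands are the components of
  \<open>z\<close>.\<close>

lemma Gram_solution_in_Ran:
  assumes "(B ** transpose B + (mat 1 - A ** X)) *v y = z" and z: "z \<in> Ran A"
  shows "y \<in> Ran A" and "B *v (transpose B *v y) = z"
proof -
  define w where "w = B *v (transpose B *v y)"
  have w: "A *v (X *v w) = w"
    using Ran_le Ran_iff_pinv[OF pinv, of w] by (auto simp: w_def)
  have eq: "w + (y - A *v (X *v y)) = z"
    using assms(1) by (simp add: w_def matrix_vector_mult_add_rdistrib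
        matrix_vector_mult_diff_rdistrib matrix_vector_mul_assoc)
  have "A *v (X *v (A *v (X *v y))) = A *v (X *v y)"
    using Ran_iff_pinv[OF pinv, of "A *v (X *v y)"] by blast
  then have "A *v (X *v z) = w"
    using w unfolding eq[symmetric] by (simp add: matrix_vector_right_distrib matrix_vector_mult_diff_distrib)
  then have "w = z"
    using z Ran_iff_pinv[OF pinv] by simp
  then show "B *v (transpose B *v y) = z" by (simp add: w_def)
  from \<open>w = z\<close> eq have "A *v (X *v y) = y" by simp
  then show "y \<in> Ran A" by (metis rangeI)
qed

lemma Gram_det_nonzero: "det (B ** transpose B + (mat 1 - A ** X)) \<noteq> 0"
proof -
  let ?M = "B ** transpose B + (mat 1 - A ** X)"
  have "y = 0" if "?M *v y = 0" for y
  proof -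
    have "0 \<in> Ran A" by (metis matrix_vector_mult_0_right rangeI)
    from Gram_solution_in_Ran[OF that this]
    have y: "y \<in> Ran A" "B *v (transpose B *v y) = 0" by auto
    then have "transpose B *v y = 0"
      by (metis inner_eq_zero_iff inner_transpose inner_zero_right)
    with margin_le_transpose[OF y(1)] margin_pos show "y = 0"
      by (simp add: mult_le_0_iff)
  qed
  then have "invertible ?M"
    unfolding invertible_left_inverse matrix_left_invertible_ker by blast
  then show ?thesis by (simp add: invertible_det_nz)
qed

text \<open>Both estimates rest on \<open>\<langle>B\<^sup>T y, w\<rangle> = \<langle>y, B w\<rangle> = \<langle>y, z\<rangle>\<close>, valid for every solution \<open>w\<close>.\<close>

lemma
  assumes z: "z \<in> Ran A"
  defines "u \<equiv> least_norm_solution A X B z"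
  shows least_norm_solution: "B *v u = z"
    and least_norm_solution_minimal: "B *v w = z \<Longrightarrow> norm u \<le> norm w"
    and norm_least_norm_solution: "norm u \<le> norm z / margin"
proof -
  define y where "y = cramer_solution (B ** transpose B + (mat 1 - A ** X)) z"
  have "(B ** transpose B + (mat 1 - A ** X)) *v y = z"
    unfolding y_def cramer_solution_def cramer[OF Gram_det_nonzero] ..
  note y = Gram_solution_in_Ran[OF this z]
  have u: "u = transpose B *v y"
    by (simp add: u_def least_norm_solution_def y_def)
  show "B *v u = z" using y(2) by (simp add: u)
  show "norm u \<le> norm w" if w: "B *v w = z" for w
  proof -
    have "u \<bullet> u = u \<bullet> w"
      using y(2) w by (simp add: u inner_transpose)
    then have "norm u * norm u \<le> norm u * norm w"
      by (metis dot_square_norm norm_cauchy_schwarz power2_eq_square)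
    then show ?thesis by (cases "norm u = 0") auto
  qed
  have "norm u * norm u = y \<bullet> z"
    using y(2) by (metis dot_square_norm inner_transpose power2_eq_square u)
  also have "\<dots> \<le> norm y * norm z" by (rule norm_cauchy_schwarz)
  also have "\<dots> \<le> (norm u / margin) * norm z"
    using margin_le_transpose[OF y(1)] margin_pos
    by (intro mult_right_mono) (simp_all add: u field_simps)
  finally have "norm u * norm u \<le> norm u * (norm z / margin)" by simp
  then have "norm u = 0 \<or> norm u \<le> norm z / margin"
    by (metis linorder_not_less mult_le_cancel_left_pos norm_ge_zero order_le_less)
  then show "norm u \<le> norm z / margin"
    using margin_pos by auto
qed

lemma subspace_Ran: "subspace (Ran A)"
  by (intro linear_subspace_image) auto

text \<open>In the next two lemmas \<open>c\<close> stands for the change of the drift between the origin and the current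
  state.\<close>

lemma ball_velocity:
  assumes c: "c \<in> Ran A" "norm c \<le> \<delta>" and w: "w \<in> Ran A" "norm w \<le> margin - \<delta>"
  shows "\<exists>u. norm u \<le> 1 \<and> c + B *v u = w"
proof -
  have "w - c \<in> Ran A"
    using subspace_Ran c w by (simp add: subspace_diff)
  moreover have "norm (w - c) / margin \<le> 1"
    using norm_triangle_ineq4[of w c] c w margin_pos by simp
  ultimately show ?thesis
    using least_norm_solution[of "w - c"] norm_least_norm_solution[of "w - c"]
    by (intro exI[of _ "least_norm_solution A X B (w - c)"]) auto
qed

text \<open>The control is \<open>k (a + e) + h\<close>, where \<open>a = X d\<close> reaches \<open>d\<close> for the unperturbed matrix, \<open>e\<close> compensates the
  error \<open>(A - B) a\<close>, and \<open>h\<close> cancels the drift \<open>c\<close>. The bound for \<open>k\<close> says that the norms add up to at most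
  \<open>1\<close>.\<close>

lemma directional_velocity:
  assumes c: "c \<in> Ran A" "norm c \<le> \<delta>" and d: "d \<in> Ran A" "norm d = 1" and "0 \<le> k"
    and k: "k * (norm (X *v d) * margin + opnorm X * \<epsilon>) \<le> margin - \<delta>"
  shows "\<exists>u. norm u \<le> 1 \<and> c + B *v u = k *\<^sub>R d"
proof -
  define a where "a = X *v d"
  have Aa: "A *v a = d"
    using d Ran_iff_pinv[OF pinv] by (simp add: a_def)
  define b where "b = d - B *v a"
  have "B *v a \<in> Ran A" using Ran_le by blast
  then have bR: "b \<in> Ran A"
    using subspace_Ran d by (simp add: b_def subspace_diff)
  have "b = - ((B - A) *v a)"
    by (simp add: b_def Aa[symmetric] matrix_vector_mult_diff_rdistrib)
  then have "norm b \<le> \<epsilon> * norm a"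
    using norm_diff_le by simp
  also have "\<dots> \<le> \<epsilon> * opnorm X"
    using norm_mult_le_opnorm[of X d] d eps_nonneg by (simp add: a_def mult_left_mono)
  finally have b: "norm b \<le> \<epsilon> * opnorm X" .
  define e where "e = least_norm_solution A X B b"
  define h where "h = least_norm_solution A X B (- c)"
  have "- c \<in> Ran A" using c subspace_Ran by (simp add: subspace_neg)
  then have h: "B *v h = - c" "norm h \<le> norm c / margin"
    using least_norm_solution norm_least_norm_solution[of "- c"] by (auto simp: h_def)
  have e: "B *v e = b" "norm e \<le> norm b / margin"
    using bR least_norm_solution norm_least_norm_solution by (auto simp: e_def)
  let ?u = "k *\<^sub>R (a + e) + h"
  have "c + B *v ?u = k *\<^sub>R d"
    using h e by (simp add: matrix_vector_right_distrib matrix_vector_mult_scaleR b_def)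
  moreover have "norm ?u \<le> 1"
  proof -
    have "margin * norm ?u \<le> margin * (k * (norm a + norm e) + norm h)"
      using margin_pos \<open>0 \<le> k\<close> norm_triangle_ineq[of "k *\<^sub>R (a + e)" h] norm_triangle_ineq[of a e]
      by (intro mult_left_mono order_trans[OF norm_triangle_ineq] add_mono) (auto simp: mult_left_mono)
    also have "\<dots> = k * (norm a * margin + margin * norm e) + margin * norm h"
      by (simp add: algebra_simps)
    also have "\<dots> \<le> k * (norm a * margin + opnorm X * \<epsilon>) + \<delta>"
      using e h b c margin_pos \<open>0 \<le> k\<close>
      by (intro add_mono mult_left_mono) (auto simp: field_simps)
    also have "\<dots> \<le> margin"
      using k by (simp add: a_def)
    finally show ?thesis using margin_pos by simp
  qed
  ultimately show ?thesis by blast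
qed

end

text \<open>Componentwise measurability carries over to determinants, and by Cramer's rule to solutions of linear
  systems.\<close>

lemma borel_measurable_vec_iff:
  fixes f :: "'a \<Rightarrow> real^'n"
  shows "f \<in> borel_measurable M \<longleftrightarrow> (\<forall>i. (\<lambda>x. f x $ i) \<in> borel_measurable M)"
  unfolding borel_measurable_euclidean_space[of f M]
  by (auto simp: Basis_vec_def inner_axis)

lemma borel_measurable_det:
  fixes F :: "'a \<Rightarrow> real^'n^'n"
  assumes "\<And>i j. (\<lambda>x. F x $ i $ j) \<in> borel_measurable M"
  shows "(\<lambda>x. det (F x)) \<in> borel_measurable M"
  unfolding det_def using assms by (intro borel_measurable_sum borel_measurable_times
      borel_measurable_prod borel_measurable_const) auto

lemma borel_measurable_cramer_solution:
  assumes "\<And>i j. (\<lambda>x. F x $ i $ j) \<in> borel_measurable M" and "z \<in> borel_measurable M"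
  shows "(\<lambda>x. cramer_solution (F x) (z x)) \<in> borel_measurable M"
  unfolding borel_measurable_vec_iff cramer_solution_def
proof (intro allI)
  fix k
  have "(\<lambda>x. if j = k then z x $ i else F x $ i $ j) \<in> borel_measurable M" for i j
    using assms unfolding borel_measurable_vec_iff[of z] by (cases "j = k") auto
  then show "(\<lambda>x. (\<chi> k. det (\<chi> i j. if j = k then z x $ i else F x $ i $ j) / det (F x)) $ k)
      \<in> borel_measurable M"
    using assms(1) by (auto intro!: borel_measurable_divide borel_measurable_det)
qed

lemma borel_measurable_matrix_mult:
  fixes F :: "'a \<Rightarrow> real^'m^'n" and z :: "'a \<Rightarrow> real^'m"
  assumes "\<And>i j. (\<lambda>x. F x $ i $ j) \<in> borel_measurable M" and "z \<in> borel_measurable M"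
  shows "(\<lambda>x. F x *v z x) \<in> borel_measurable M"
  using assms unfolding borel_measurable_vec_iff[of z] borel_measurable_vec_iff
  by (auto simp: matrix_vector_mult_def intro!: borel_measurable_sum borel_measurable_times)

lemma borel_measurable_least_norm_solution:
  assumes F: "\<And>i j. (\<lambda>x. F x $ i $ j) \<in> borel_measurable M" and "z \<in> borel_measurable M"
  shows "(\<lambda>x. least_norm_solution A X (F x) (z x)) \<in> borel_measurable M"
  unfolding least_norm_solution_def
  using assms
  by (intro borel_measurable_matrix_mult borel_measurable_cramer_solution)
    (auto simp: transpose_def matrix_matrix_mult_def)

section \<open>Velocities of consistent systems\<close>

text \<open>As \<open>mu\<close> occurs in the denominator of \<open>K(d)\<close>, a lower bound for \<open>mu\<close> is an upper bound for
  \<open>K(d)\<close>.\<close>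

lemma mu_ge_1: "mu A \<ge> 1"
  unfolding mu_def by (simp add: real_le_rsqrt)

lemma factors_Ran:
  assumes "factors f G R \<rho> H"
  shows "Ran R = Ran (G 0)" and "f x \<in> Ran (G 0)" and "Ran (G x) \<subseteq> Ran (G 0)"
proof -
  have f: "f x = R *v \<rho> x" and G: "G x = R ** H x" and G0: "G 0 = R ** H 0" and "invertible (H 0)"
    using assms by (auto simp: factors_def)
  then obtain H' where "H 0 ** H' = mat 1"
    by (auto simp: invertible_def)
  then have "R *v w = G 0 *v (H' *v w)" for w
    by (simp add: G0 matrix_vector_mul_assoc matrix_mul_assoc[symmetric])
  then have "Ran R \<subseteq> Ran (G 0)" by (auto intro: range_eqI)
  moreover have sub: "Ran (R ** M) \<subseteq> Ran R" for M
    by (auto simp flip: matrix_vector_mul_assoc)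
  ultimately show R: "Ran R = Ran (G 0)" unfolding G0 using sub[of "H 0"] by (rule_tac equalityI) (simp_all add: G0)
  show "f x \<in> Ran (G 0)" unfolding f R[symmetric] by blast
  show "Ran (G x) \<subseteq> Ran (G 0)" unfolding G R[symmetric] by (rule sub)
qed

lemma gap_nonneg:
  assumes "Lf > 0" "LG > 0" and "x \<in> state_domain Lf LG A"
  shows "0 \<le> gap Lf LG A (norm x)"
proof -
  have "norm x * (Lf + LG) \<le> inverse (opnorm (pinv A))"
    using assms by (simp add: state_domain_def pos_le_divide_eq)
  then show ?thesis by (simp add: gap_def algebra_simps)
qed

text \<open>On the domain \<open>(L\<^sub>G + L\<^sub>f) \<parallel>x\<parallel> \<le> 1/\<parallel>X\<parallel>\<close>; as \<open>L\<^sub>f > 0\<close>, the perturbation is strictly smaller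
  than \<open>1/\<parallel>X\<parallel>\<close> even on the boundary.\<close>

lemma consistent_perturbation:
  assumes "Lf > 0" "LG > 0" and X: "is_pinv A X" "A \<noteq> 0"
    and con: "(f, G) \<in> D_con Lf LG f0 A" and x: "x \<in> state_domain Lf LG A"
  shows "range_preserving_perturbation A (G x) X (LG * norm x)"
proof
  obtain R \<rho> H where "factors f G R \<rho> H" and G: "op_lipschitz LG G" "G 0 = A"
    using con by (auto simp: D_con_def)
  then show "Ran (G x) \<subseteq> Ran A" using factors_Ran by metis
  show "opnorm (G x - A) \<le> LG * norm x"
    using G unfolding op_lipschitz_def by (metis diff_zero)
  show "is_pinv A X" by fact
  have "LG * norm x + Lf * norm x \<le> inverse (opnorm X)"
    using gap_nonneg[OF assms(1,2) x] pinv_eqI[OF X(1)] by (simp add: gap_def algebra_simps)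
  then show "LG * norm x < inverse (opnorm X)"
    using opnorm_pinv_pos[OF X] \<open>Lf > 0\<close>
    by (cases "x = 0") (auto simp: add_pos_pos intro: less_le_trans[of _ "LG * norm x + Lf * norm x"])
qed

lemma V_hat_subset_velocities:
  assumes "Lf > 0" "LG > 0" and X: "is_pinv A X" "A \<noteq> 0"
    and con: "(f, G) \<in> D_con Lf LG f0 A" and x: "x \<in> state_domain Lf LG A"
    and R: "Ran R = Ran A" and v: "v \<in> V_hat Lf LG f0 A R x"
  shows "\<exists>u. norm u \<le> 1 \<and> f x + G x *v u = v"
proof -
  interpret range_preserving_perturbation A "G x" X "LG * norm x"
    using consistent_perturbation assms by blast
  have pinv_A: "pinv A = X" by (rule pinv_eqI[OF X(1)])
  obtain R' \<rho> H where "factors f G R' \<rho> H" and f: "Lf-lipschitz_on UNIV f" "f 0 = f0" and G: "G 0 = A"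
    using con by (auto simp: D_con_def)
  from factors_Ran(2)[OF this(1)] have fR: "f y \<in> Ran A" for y unfolding G .
  then have cR: "f x - f0 \<in> Ran A" and f0R: "f0 \<in> Ran A"
    using subspace_Ran f(2) by (auto intro: subspace_diff)
  have c: "norm (f x - f0) \<le> Lf * norm x"
    using lipschitz_onD[OF f(1), of x 0] f(2) by (simp add: dist_norm)
  from v consider "v \<in> V_ball Lf LG f0 A x" | "v \<in> V_dir Lf LG f0 A R x"
    by (auto simp: V_hat_def)
  then have "\<exists>u. norm u \<le> 1 \<and> (f x - f0) + G x *v u = v - f0"
  proof cases
    case 1
    then have "v - f0 \<in> Ran A"
      using f0R subspace_Ran by (auto simp: V_ball_def intro: subspace_diff)
    moreover have "norm (v - f0) \<le> margin - Lf * norm x"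
      using 1 by (simp add: V_ball_def margin_def pinv_A dist_norm norm_minus_commute algebra_simps)
    ultimately show ?thesis by (rule ball_velocity[OF cR c])
  next
    case 2
    then obtain k d where kd: "v = f0 + k *\<^sub>R d" "norm d = 1" "d \<in> Ran A" "0 \<le> k"
      and k: "k \<le> K_bound Lf LG A x d"
      unfolding V_dir_def R by blast
    let ?D = "norm (X *v d) * margin + mu A * opnorm X * (LG * norm x)"
    have K: "K_bound Lf LG A x d = (margin - Lf * norm x) / ?D"
      by (simp add: K_bound_def pinv_A margin_def algebra_simps)
    have N: "0 \<le> margin - Lf * norm x"
      using gap_nonneg[OF assms(1,2) x] by (simp add: gap_def margin_def pinv_A algebra_simps)
    have "opnorm X * (LG * norm x) \<le> mu A * (opnorm X * (LG * norm x))"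
      using mult_right_mono[OF mu_ge_1, of "opnorm X * (LG * norm x)" A] opnorm_X_pos \<open>LG > 0\<close> by simp
    moreover from this have "0 \<le> ?D"
      using margin_pos opnorm_X_pos \<open>LG > 0\<close> mu_ge_1[of A]
      by (intro add_nonneg_nonneg mult_nonneg_nonneg) simp_all
    ultimately have D: "norm (X *v d) * margin + opnorm X * (LG * norm x) \<le> ?D" "0 \<le> ?D"
      by (simp_all add: mult.assoc)
    have "k * (norm (X *v d) * margin + opnorm X * (LG * norm x)) \<le> k * ?D"
      by (rule mult_left_mono[OF D(1) kd(4)])
    moreover have "k * ?D \<le> margin - Lf * norm x"
    proof (cases "?D = 0")
      case True
      then show ?thesis using N by (simp only: mult_zero_right)
    next
      case False
      with D(2) have "0 < ?D" by (simp only: order_le_neq_trans)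
      with k show ?thesis unfolding K by (simp only: pos_le_divide_eq)
    qed
    ultimately have "k * (norm (X *v d) * margin + opnorm X * (LG * norm x)) \<le> margin - Lf * norm x"
      by linarith
    from directional_velocity[OF cR c kd(3,2,4) this] kd(1) show ?thesis by simp
  qed
  then obtain u where "norm u \<le> 1" "(f x - f0) + G x *v u = v - f0" by blast
  then have "norm u \<le> 1 \<and> f x + G x *v u = v" by (simp add: algebra_simps)
  then show ?thesis ..
qed

section \<open>The hull of the extremal points\<close>

text \<open>With \<open>s = \<Sum>\<bar>u\<^sub>j\<bar>\<close>, the point is the convex combination of \<open>c\<close>, with weight \<open>1 - s\<close>, and the points
  \<open>c \<plusminus> b\<^sub>j\<close>, with weights \<open>\<bar>u\<^sub>j\<bar>\<close>.\<close>

lemma cross_polytope_subset_convex: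
  fixes b :: "'m::finite \<Rightarrow> 'a::real_vector"
  assumes C: "convex C" and c: "c \<in> C" and b: "\<And>j. c + b j \<in> C" "\<And>j. c - b j \<in> C"
    and u: "(\<Sum>j\<in>UNIV. \<bar>u j\<bar>) \<le> 1"
  shows "c + (\<Sum>j\<in>UNIV. u j *\<^sub>R b j) \<in> C"
proof (cases "(\<Sum>j\<in>UNIV. \<bar>u j\<bar>) = 0")
  case True
  then have "u j = 0" for j by (simp add: sum_nonneg_eq_0_iff)
  then show ?thesis using c by simp
next
  case False
  define s where "s = (\<Sum>j\<in>UNIV. \<bar>u j\<bar>)"
  have "0 \<le> s" "s \<noteq> 0" and "s \<le> 1"
    using False u unfolding s_def by (auto intro: sum_nonneg)
  then have s: "0 < s" "s \<le> 1" by simp_all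
  have "c + sgn (u j) *\<^sub>R b j \<in> C" for j
    using b[of j] c by (cases "u j" "0::real" rule: linorder_cases) auto
  then have y: "(\<Sum>j\<in>UNIV. (\<bar>u j\<bar> / s) *\<^sub>R (c + sgn (u j) *\<^sub>R b j)) \<in> C" (is "?y \<in> C")
    using s by (intro convex_sum[OF _ C]) (auto simp: s_def simp flip: sum_divide_distrib)
  have "\<bar>t\<bar> * sgn t = t" for t :: real by (simp add: abs_sgn_eq sgn_if)
  then have "s *\<^sub>R ?y = (\<Sum>j\<in>UNIV. \<bar>u j\<bar> *\<^sub>R c + u j *\<^sub>R b j)"
    using s by (simp add: scaleR_sum_right scaleR_right_distrib)
  also have "\<dots> = s *\<^sub>R c + (\<Sum>j\<in>UNIV. u j *\<^sub>R b j)"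
    by (simp add: sum.distrib s_def scaleR_sum_left)
  finally have "c + (\<Sum>j\<in>UNIV. u j *\<^sub>R b j) = (1 - s) *\<^sub>R c + s *\<^sub>R ?y"
    by (simp add: scaleR_left_diff_distrib)
  then show ?thesis
    using convexD[OF C c y, of "1 - s" s] s by simp
qed

locale velocity_setting = singular_value_decomposition A U V p q D
  for A :: "real^'m^'n" and U V p q D +
  fixes R :: "real^'m^'n" and f0 :: "real^'n" and Lf LG :: real
  assumes Lf: "Lf > 0" and LG: "LG > 0" and A: "A \<noteq> 0"
    and Ran_R: "Ran R = Ran A" and f0: "f0 \<in> Ran A"
begin

abbreviation "states \<equiv> state_domain Lf LG A"
abbreviation "system \<equiv> svd_system Lf LG f0 A p q U"
abbreviation "controls \<equiv> svd_controls A V"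

lemma lam_nonneg: "0 \<le> lam Lf LG A p U s i"
  by (simp add: lam_def max.coboundedI2)

text \<open>A ray from \<open>f0\<close> along a unit vector \<open>v\<close> stays in the ball up to \<open>g\<close>, and it meets the directional part
  up to \<open>K(v)\<close>, provided that \<open>v\<close> lies in the range; otherwise it meets both in \<open>f0\<close> only. Hence the
  union is a segment whose length is the maximum in the definition of \<open>\<lambda>\<^sub>i\<close>, which is \<open>0\<close> for \<open>i > r\<close>.\<close>

lemma V_hat_ray_iff:
  assumes x: "x \<in> states" and v: "v = column i U \<or> v = - column i U" and t: "0 \<le> t"
  shows "f0 + t *\<^sub>R v \<in> V_hat Lf LG f0 A R x \<longleftrightarrow> t \<le> lam Lf LG A p U (norm x) i"
proof -
  have subspace_Ran: "subspace (Ran A)"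
    by (intro linear_subspace_image) auto
  have g: "0 \<le> gap Lf LG A (norm x)"
    using gap_nonneg Lf LG x by blast
  have nv: "norm v = 1"
    using v U by (auto simp: orthogonal_matrix_orthonormal_columns)
  have vR: "v \<in> Ran A \<longleftrightarrow> p i \<le> rank A"
    using v subspace_Ran column_in_Ran_iff row_active_iff
    by (metis add.inverse_inverse subspace_neg)
  have tv: "f0 + t *\<^sub>R v \<in> Ran A \<longleftrightarrow> t = 0 \<or> p i \<le> rank A"
  proof -
    have "f0 + t *\<^sub>R v \<in> Ran A \<longleftrightarrow> t *\<^sub>R v \<in> Ran A"
      using f0 subspace_Ran by (metis add_diff_cancel_left' subspace_add subspace_diff)
    also have "\<dots> \<longleftrightarrow> t = 0 \<or> v \<in> Ran A"
    proof (cases "t = 0")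
      case True
      then show ?thesis using subspace_0[OF subspace_Ran] by simp
    next
      case False
      then have "v = inverse t *\<^sub>R (t *\<^sub>R v)" by simp
      with False show ?thesis by (metis subspace_Ran subspace_scale)
    qed
    finally show ?thesis by (simp add: vR)
  qed
  have ball: "f0 + t *\<^sub>R v \<in> V_ball Lf LG f0 A x \<longleftrightarrow> t \<le> gap Lf LG A (norm x) \<and> (t = 0 \<or> p i \<le> rank A)"
    using t nv by (simp add: V_ball_def tv dist_norm gap_def algebra_simps)
  have K: "K_bound Lf LG A x v = gap Lf LG A (norm x) /
      (alpha LG A (norm x) * norm (pinv A *v column i U) + beta LG A (norm x))"
  proof -
    have "pinv A *v - column i U = - (pinv A *v column i U)"
      by (rule linear_neg[OF matrix_vector_mul_linear])
    then have "norm (pinv A *v v) = norm (pinv A *v column i U)"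
      using v by auto
    then show ?thesis
      by (simp add: K_bound_def gap_def alpha_def beta_def algebra_simps)
  qed
  have dir: "f0 + t *\<^sub>R v \<in> V_dir Lf LG f0 A R x \<longleftrightarrow> p i \<le> rank A \<and> t \<le> K_bound Lf LG A x v" if "t \<noteq> 0"
  proof
    assume "f0 + t *\<^sub>R v \<in> V_dir Lf LG f0 A R x"
    then obtain k d where kd: "t *\<^sub>R v = k *\<^sub>R d" "norm d = 1" "d \<in> Ran A" "0 \<le> k" "k \<le> K_bound Lf LG A x d"
      unfolding V_dir_def Ran_R by auto
    then have "k = t" using nv t by (metis abs_of_nonneg mult.right_neutral norm_scaleR)
    then have "d = v" using kd(1) \<open>t \<noteq> 0\<close> by simp
    with \<open>k = t\<close> kd show "p i \<le> rank A \<and> t \<le> K_bound Lf LG A x v" using vR by simp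
  next
    assume "p i \<le> rank A \<and> t \<le> K_bound Lf LG A x v"
    then show "f0 + t *\<^sub>R v \<in> V_dir Lf LG f0 A R x"
      unfolding V_dir_def Ran_R using vR nv t by blast
  qed
  show ?thesis
  proof (cases "t = 0")
    case True
    then show ?thesis using ball g lam_nonneg by (simp add: V_hat_def)
  next
    case False
    have lam: "lam Lf LG A p U (norm x) i = (if p i \<le> rank A
        then max (K_bound Lf LG A x v) (max (gap Lf LG A (norm x)) 0) else 0)"
      unfolding lam_def K by simp
    have V_hat: "f0 + t *\<^sub>R v \<in> V_hat Lf LG f0 A R x \<longleftrightarrow>
        p i \<le> rank A \<and> (t \<le> gap Lf LG A (norm x) \<or> t \<le> K_bound Lf LG A x v)"
      unfolding V_hat_def Un_iff ball dir[OF False] using False by blast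
    from t False have "\<not> t \<le> 0" by simp
    then show ?thesis
      unfolding V_hat lam by (cases "p i \<le> rank A") (simp_all only: if_True if_False le_max_iff_disj simp_thms, blast)
  qed
qed

lemma S_set_eq:
  assumes "x \<in> states"
  shows "S_set Lf LG f0 A R U x =
    {f0 + lam Lf LG A p U (norm x) i *\<^sub>R v | i v. v = column i U \<or> v = - column i U}"
proof -
  define far where "far v = (GREATEST t. 0 \<le> t \<and> f0 + t *\<^sub>R v \<in> V_hat Lf LG f0 A R x)" for v
  have far: "far v = lam Lf LG A p U (norm x) i" if "v = column i U \<or> v = - column i U" for v i
    unfolding far_def using V_hat_ray_iff[OF assms that] lam_nonneg
    by (intro Greatest_equality) auto
  have "S_set Lf LG f0 A R U x = {f0 + far v *\<^sub>R v | v. \<exists>i. v = column i U \<or> v = - column i U}"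
    unfolding S_set_def far_def ..
  also have "\<dots> = {f0 + lam Lf LG A p U (norm x) i *\<^sub>R v | i v. v = column i U \<or> v = - column i U}"
    by (intro set_eqI iffI; clarsimp) (metis far)+
  finally show ?thesis .
qed

lemma S_set_subset_V_hat:
  assumes "x \<in> states"
  shows "S_set Lf LG f0 A R U x \<subseteq> V_hat Lf LG f0 A R x"
proof
  fix y assume "y \<in> S_set Lf LG f0 A R U x"
  then obtain i v where "y = f0 + lam Lf LG A p U (norm x) i *\<^sub>R v" "v = column i U \<or> v = - column i U"
    unfolding S_set_eq[OF assms] by blast
  then show "y \<in> V_hat Lf LG f0 A R x"
    using V_hat_ray_iff[OF assms, of v i] lam_nonneg by simp
qed

lemma Lam_mult:
  "(Lam Lf LG A p q U s *v u) $ i = (\<Sum>j\<in>UNIV. if q j = p i then lam Lf LG A p U s i * u $ j else 0)"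
  unfolding Lam_def by (rule rect_diag_mult_vec[OF inj_q])

lemma Lam_mult_axis:
  "Lam Lf LG A p q U s *v axis j 1 =
    (if q j \<in> range p then lam Lf LG A p U s (inv p (q j)) *\<^sub>R axis (inv p (q j)) 1 else 0)"
proof -
  have "(\<Sum>k\<in>UNIV. if q k = p i then lam Lf LG A p U s i * axis j 1 $ k else 0)
      = (\<Sum>k\<in>UNIV. if k = j then (if p i = q j then lam Lf LG A p U s i else 0) else 0)" for i
    by (intro sum.cong) (auto simp: axis_def)
  then have comp: "(Lam Lf LG A p q U s *v axis j 1) $ i = (if p i = q j then lam Lf LG A p U s i else 0)" for i
    unfolding Lam_mult by simp
  show ?thesis
  proof (cases "q j \<in> range p")
    case True
    then obtain k where k: "q j = p k" by blast
    then show ?thesis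
      unfolding vec_eq_iff comp using inj_p by (simp add: axis_def inj_eq inv_f_f)
  next
    case False
    then have "p i \<noteq> q j" for i by (metis rangeI)
    with False show ?thesis unfolding vec_eq_iff comp by simp
  qed
qed

lemma system_axis:
  "U *v (Lam Lf LG A p q U s *v axis j 1) =
    (if q j \<in> range p then lam Lf LG A p U s (inv p (q j)) *\<^sub>R column (inv p (q j)) U else 0)"
  unfolding Lam_mult_axis by (simp add: matrix_vector_mult_scaleR matrix_vector_mult_basis)

lemma system_eq:
  "system x u = f0 + (\<Sum>j\<in>UNIV. u $ j *\<^sub>R (U *v (Lam Lf LG A p q U (norm x) *v axis j 1)))"
proof -
  have "(U ** Lam Lf LG A p q U (norm x)) *v u = (\<Sum>j\<in>UNIV. u $ j *\<^sub>R ((U ** Lam Lf LG A p q U (norm x)) *v axis j 1))"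
    unfolding matrix_vector_mult_basis by (simp only: matrix_mult_sum scalar_mult_eq_scaleR)
  then show ?thesis by (simp only: svd_system_def matrix_vector_mul_assoc)
qed

text \<open>Since \<open>\<Lambda>\<close> annihilates the inactive coordinates, this holds for every \<open>u\<close> in the unit ball of the
  1-norm, and so for either reading of the control set.\<close>

lemma system_in_hull:
  assumes x: "x \<in> states" and u: "norm1 u \<le> 1"
  shows "system x u \<in> convex hull (S_set Lf LG f0 A R U x)"
  unfolding system_eq
proof (rule cross_polytope_subset_convex)
  let ?C = "convex hull (S_set Lf LG f0 A R U x)" and ?l = "lam Lf LG A p U (norm x)"
  have pm: "f0 + ?l i *\<^sub>R column i U \<in> ?C" "f0 - ?l i *\<^sub>R column i U \<in> ?C" for i
    unfolding S_set_eq[OF x] by (intro hull_inc, force)+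
  have "(1/2) *\<^sub>R (f0 + b) + (1/2) *\<^sub>R (f0 - b) = f0" for b
    by (simp flip: scaleR_right_distrib)
  then show f0C: "f0 \<in> ?C"
    using convexD[OF convex_convex_hull pm, of "1/2" "1/2" undefined undefined] by simp
  show "f0 + U *v (Lam Lf LG A p q U (norm x) *v axis j 1) \<in> ?C"
       "f0 - U *v (Lam Lf LG A p q U (norm x) *v axis j 1) \<in> ?C" for j
    using pm f0C by (auto simp: system_axis)
  show "(\<Sum>j\<in>UNIV. \<bar>u $ j\<bar>) \<le> 1" using u by (simp add: norm1_def)
qed (rule convex_convex_hull)

lemma controls_eq: "controls = {u. norm1 u \<le> 1 \<and> (\<forall>j. q j \<notin> active \<longrightarrow> u $ j = 0)}"
  unfolding svd_controls_def using coordinates_in_Ran_transpose_iff by auto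

lemma convex_controls: "convex controls"
proof (rule convexI)
  fix u w :: "real^'m" and a b :: real
  assume uw: "u \<in> controls" "w \<in> controls" and ab: "0 \<le> a" "0 \<le> b" "a + b = 1"
  have "norm1 (a *\<^sub>R u + b *\<^sub>R w) \<le> a * norm1 u + b * norm1 w"
    unfolding norm1_def sum_distrib_left sum.distrib[symmetric]
    using ab by (intro sum_mono) (metis abs_mult abs_of_nonneg abs_triangle_ineq
        vector_add_component vector_scaleR_component real_scaleR_def)
  also have "\<dots> \<le> 1" using uw ab by (intro convex_bound_le) (auto simp: controls_eq)
  finally show "a *\<^sub>R u + b *\<^sub>R w \<in> controls" using uw by (simp add: controls_eq)
qed

lemma hull_eq:
  assumes x: "x \<in> states"
  shows "convex hull (S_set Lf LG f0 A R U x) = system x ` controls"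
proof (rule antisym)
  have "convex ((\<lambda>y. f0 + y) ` ((*v) (U ** Lam Lf LG A p q U (norm x)) ` controls))"
    by (intro convex_translation convex_linear_image convex_controls) auto
  then have "convex (system x ` controls)"
    by (simp add: image_image svd_system_def[abs_def])
  moreover have "S_set Lf LG f0 A R U x \<subseteq> system x ` controls"
  proof
    fix y assume "y \<in> S_set Lf LG f0 A R U x"
    then obtain i and \<sigma> :: real where y: "y = f0 + (lam Lf LG A p U (norm x) i * \<sigma>) *\<^sub>R column i U" and \<sigma>: "\<bar>\<sigma>\<bar> = 1"
    proof -
      obtain i v where iv: "y = f0 + lam Lf LG A p U (norm x) i *\<^sub>R v" "v = column i U \<or> v = - column i U"
        using \<open>y \<in> _\<close> unfolding S_set_eq[OF x] by blast
      from iv(2) show thesis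
        by (elim disjE) (use iv(1) in \<open>auto intro: that[of i 1] that[of i "-1"]\<close>)
    qed
    show "y \<in> system x ` controls"
    proof (cases "p i \<in> active")
      case True
      then obtain j where j: "p i = q j" by (auto simp: active_def)
      then have "q j \<in> range p" "inv p (q j) = i"
        using inj_p by (metis rangeI, metis inv_f_f)
      then have "system x (\<sigma> *\<^sub>R axis j 1) = y"
        by (simp add: y svd_system_def matrix_vector_mult_scaleR system_axis mult.commute
            flip: matrix_vector_mul_assoc)
      moreover have "(\<Sum>k\<in>UNIV. \<bar>\<sigma> * axis j 1 $ k\<bar>) = (\<Sum>k\<in>UNIV. if k = j then 1 else 0)"
        using \<sigma> by (intro sum.cong) (auto simp: axis_def abs_mult)
      then have "norm1 (\<sigma> *\<^sub>R axis j 1) \<le> 1"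
        by (simp add: norm1_def)
      ultimately show ?thesis
        using True j by (intro image_eqI[of _ _ "\<sigma> *\<^sub>R axis j 1"]) (auto simp: controls_eq axis_def)
    next
      case False
      then have "y = system x 0"
        by (simp add: y svd_system_def lam_def row_active_iff)
      then show ?thesis by (intro image_eqI[of _ _ 0]) (auto simp: controls_eq norm1_def)
    qed
  qed
  ultimately show "convex hull (S_set Lf LG f0 A R U x) \<subseteq> system x ` controls"
    by (rule hull_minimal[rotated])
  show "system x ` controls \<subseteq> convex hull (S_set Lf LG f0 A R U x)"
    using system_in_hull[OF x] by (auto simp: svd_controls_def)
qed

text \<open>The set of velocities that a system affine in the control realizes is convex, so it suffices to
  realize the extremal points.\<close>

lemma system_velocity_realizable:
  assumes con: "(f, G) \<in> D_con Lf LG f0 A" and x: "x \<in> states" and u: "norm1 u \<le> 1"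
  shows "\<exists>w. norm w \<le> 1 \<and> f x + G x *v w = system x u"
proof -
  let ?vel = "(\<lambda>w. f x + G x *v w) ` cball 0 1"
  have "convex ((\<lambda>y. f x + y) ` ((*v) (G x) ` cball 0 1))"
    by (intro convex_translation convex_linear_image) auto
  then have "convex ?vel" by (simp add: image_image)
  moreover have "S_set Lf LG f0 A R U x \<subseteq> ?vel"
    using S_set_subset_V_hat[OF x] V_hat_subset_velocities[OF Lf LG is_pinv_X A con x Ran_R]
    by (force simp: image_iff)
  ultimately have "convex hull (S_set Lf LG f0 A R U x) \<subseteq> ?vel"
    by (rule hull_minimal[rotated])
  then show ?thesis using system_in_hull[OF x u] by (force simp: image_iff)
qed

text \<open>A measurable right inverse of the map from controls to velocities: the coordinates of \<open>v - f0\<close>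
  with respect to the columns of \<open>U\<close> are divided by the \<open>\<lambda>\<^sub>i\<close>. Where \<open>\<lambda>\<^sub>i = 0\<close>, division by zero yields
  the coordinate \<open>0\<close>; this keeps the 1-norm small and does not change the velocity.\<close>

definition recovered_control :: "real \<Rightarrow> real^'n \<Rightarrow> real^'m"
  where "recovered_control s v = (\<chi> j. if q j \<in> active
    then (transpose U *v (v - f0)) $ inv p (q j) / lam Lf LG A p U s (inv p (q j)) else 0)"

lemma recovered_control:
  fixes x :: "real^'n"
  assumes u: "u \<in> controls"
  defines "w \<equiv> recovered_control (norm x) (system x u)"
  shows "w \<in> controls" and "system x w = system x u"
proof -
  let ?l = "\<lambda>i. lam Lf LG A p U (norm x) i"
  have "transpose U *v (system x u - f0) = transpose U ** U *v (Lam Lf LG A p q U (norm x) *v u)"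
    by (simp add: svd_system_def matrix_vector_mul_assoc matrix_mul_assoc)
  then have coord: "transpose U *v (system x u - f0) = Lam Lf LG A p q U (norm x) *v u"
    by (simp add: U_left)
  have Lam_j: "(Lam Lf LG A p q U (norm x) *v z) $ i = ?l i * z $ j" if "p i = q j" for i j z
  proof -
    have "(\<Sum>k\<in>UNIV. if q k = p i then ?l i * z $ k else 0) = (\<Sum>k\<in>UNIV. if k = j then ?l i * z $ j else 0)"
      using that inj_q by (intro sum.cong) (auto simp: inj_eq)
    then show ?thesis unfolding Lam_mult by simp
  qed
  have w: "w $ j = (if q j \<in> active \<and> ?l (inv p (q j)) \<noteq> 0 then u $ j else 0)" for j
  proof (cases "q j \<in> active")
    case True
    then have "p (inv p (q j)) = q j" by (simp add: active_def f_inv_into_f)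
    then show ?thesis
      using Lam_j[of "inv p (q j)" j u] True by (simp add: w_def recovered_control_def coord)
  qed (simp add: w_def recovered_control_def)
  then have "norm1 w \<le> norm1 u"
    unfolding norm1_def by (intro sum_mono) simp
  then show "w \<in> controls" using u w by (simp add: controls_eq)
  have "Lam Lf LG A p q U (norm x) *v w = Lam Lf LG A p q U (norm x) *v u"
  proof (subst vec_eq_iff, intro allI)
    fix i
    have "?l i * w $ j = ?l i * u $ j" if "q j = p i" for j
      using that u inj_p w[of j] by (auto simp: controls_eq inv_f_f)
    then show "(Lam Lf LG A p q U (norm x) *v w) $ i = (Lam Lf LG A p q U (norm x) *v u) $ i"
      unfolding Lam_mult by (intro sum.cong) auto
  qed
  then show "system x w = system x u"
    by (simp add: svd_system_def flip: matrix_vector_mul_assoc)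
qed

end

section \<open>Absolutely continuous functions and ordinary differential equations\<close>

lemma abs_continuous_onD:
  assumes "abs_continuous_on I \<phi>" and "0 < \<epsilon>"
  shows "\<exists>\<delta>>0. \<forall>(N::nat) a b. (\<forall>k<N. a k \<le> b k \<and> {a k..b k} \<subseteq> I) \<longrightarrow>
      disjoint_family_on (\<lambda>k. {a k<..<b k}) {..<N} \<longrightarrow> (\<Sum>k<N. b k - a k) < \<delta>
      \<longrightarrow> (\<Sum>k<N. norm (\<phi> (b k) - \<phi> (a k))) < \<epsilon>"
  using assms(1)[unfolded abs_continuous_on_def, rule_format, OF assms(2)] by (simp only: imp_conjL)

lemma abs_continuous_on_imp_continuous_on:
  fixes \<phi> :: "real \<Rightarrow> 'a::real_normed_vector"
  assumes "abs_continuous_on {a..b} \<phi>"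
  shows "continuous_on {a..b} \<phi>"
  unfolding continuous_on_iff
proof (intro ballI allI impI)
  fix x \<epsilon> :: real assume x: "x \<in> {a..b}" and "0 < \<epsilon>"
  obtain \<delta> where "\<delta> > 0" and \<delta>: "\<forall>(N::nat) a' b'. (\<forall>k<N. a' k \<le> b' k \<and> {a' k..b' k} \<subseteq> {a..b}) \<longrightarrow>
      disjoint_family_on (\<lambda>k. {a' k<..<b' k}) {..<N} \<longrightarrow> (\<Sum>k<N. b' k - a' k) < \<delta>
      \<longrightarrow> (\<Sum>k<N. norm (\<phi> (b' k) - \<phi> (a' k))) < \<epsilon>"
    using abs_continuous_onD[OF assms \<open>0 < \<epsilon>\<close>] by (elim exE conjE)
  have "dist (\<phi> y) (\<phi> x) < \<epsilon>" if y: "y \<in> {a..b}" "dist y x < \<delta>" for y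
  proof -
    have "(\<Sum>k<1::nat. norm (\<phi> (max x y) - \<phi> (min x y))) < \<epsilon>"
      using x y by (intro \<delta>[rule_format]) (auto simp: disjoint_family_on_def dist_real_def)
    then show ?thesis
      by (cases "x \<le> y") (auto simp: dist_norm norm_minus_commute)
  qed
  with \<open>\<delta> > 0\<close> show "\<exists>d>0. \<forall>y\<in>{a..b}. dist y x < d \<longrightarrow> dist (\<phi> y) (\<phi> x) < \<epsilon>"
    by blast
qed

lemma lipschitz_imp_abs_continuous_on:
  fixes \<phi> :: "real \<Rightarrow> 'a::real_normed_vector"
  assumes "L-lipschitz_on I \<phi>"
  shows "abs_continuous_on I \<phi>"
  unfolding abs_continuous_on_def
proof (intro allI impI)
  fix \<epsilon> :: real assume "0 < \<epsilon>"
  have L: "0 \<le> L" using assms by (rule lipschitz_on_nonneg)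
  have "(\<Sum>k<N. norm (\<phi> (b k) - \<phi> (a k))) < \<epsilon>"
    if I: "\<forall>k<N. a k \<le> b k \<and> {a k..b k} \<subseteq> I" and s: "(\<Sum>k<N. b k - a k) < \<epsilon> / (L + 1)"
    for N :: nat and a b
  proof -
    have "(\<Sum>k<N. norm (\<phi> (b k) - \<phi> (a k))) \<le> (\<Sum>k<N. L * (b k - a k))"
    proof (rule sum_mono)
      fix k assume "k \<in> {..<N}"
      then have "a k \<le> b k" "{a k..b k} \<subseteq> I" using I by auto
      then have "a k \<le> b k" "a k \<in> I" "b k \<in> I" by auto
      then show "norm (\<phi> (b k) - \<phi> (a k)) \<le> L * (b k - a k)"
        using lipschitz_onD[OF assms, of "b k" "a k"] by (simp add: dist_norm)
    qed
    also have "\<dots> \<le> (L + 1) * (\<Sum>k<N. b k - a k)"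
      using I by (auto simp: sum_distrib_left intro!: sum_mono mult_right_mono)
    also have "\<dots> < \<epsilon>" using s L by (simp add: pos_less_divide_eq mult.commute)
    finally show ?thesis .
  qed
  then show "\<exists>\<delta>>0. \<forall>(N::nat) a b. (\<forall>k<N. a k \<le> b k \<and> {a k..b k} \<subseteq> I) \<and>
      disjoint_family_on (\<lambda>k. {a k<..<b k}) {..<N} \<and> (\<Sum>k<N. b k - a k) < \<delta> \<longrightarrow>
      (\<Sum>k<N. norm (\<phi> (b k) - \<phi> (a k))) < \<epsilon>"
    using \<open>0 < \<epsilon>\<close> L by (intro exI[of _ "\<epsilon> / (L + 1)"]) auto
qed

text \<open>Every interval is cut at \<open>c\<close>. The left and the right pieces are again disjoint families of no larger
  total length, and the increment of the glued function is the sum of the increments over the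
  pieces.\<close>

lemma abs_continuous_on_glue:
  fixes \<phi> \<psi> :: "real \<Rightarrow> 'a::real_normed_vector"
  assumes ac: "abs_continuous_on {a..c} \<phi>" "abs_continuous_on {c..b} \<psi>"
    and eq: "\<phi> c = \<psi> c" and acb: "a \<le> c" "c \<le> b"
  shows "abs_continuous_on {a..b} (\<lambda>\<tau>. if \<tau> \<le> c then \<phi> \<tau> else \<psi> \<tau>)" (is "abs_continuous_on _ ?\<chi>")
  unfolding abs_continuous_on_def
proof (intro allI impI)
  fix \<epsilon> :: real assume "0 < \<epsilon>"
  then have "0 < \<epsilon> / 2" by simp
  obtain \<delta>1 where "\<delta>1 > 0" and \<delta>1: "\<forall>(N::nat) a' b'. (\<forall>k<N. a' k \<le> b' k \<and> {a' k..b' k} \<subseteq> {a..c}) \<longrightarrow>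
      disjoint_family_on (\<lambda>k. {a' k<..<b' k}) {..<N} \<longrightarrow> (\<Sum>k<N. b' k - a' k) < \<delta>1
      \<longrightarrow> (\<Sum>k<N. norm (\<phi> (b' k) - \<phi> (a' k))) < \<epsilon> / 2"
    using abs_continuous_onD[OF ac(1) \<open>0 < \<epsilon> / 2\<close>] by (elim exE conjE)
  obtain \<delta>2 where "\<delta>2 > 0" and \<delta>2: "\<forall>(N::nat) a' b'. (\<forall>k<N. a' k \<le> b' k \<and> {a' k..b' k} \<subseteq> {c..b}) \<longrightarrow>
      disjoint_family_on (\<lambda>k. {a' k<..<b' k}) {..<N} \<longrightarrow> (\<Sum>k<N. b' k - a' k) < \<delta>2
      \<longrightarrow> (\<Sum>k<N. norm (\<psi> (b' k) - \<psi> (a' k))) < \<epsilon> / 2"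
    using abs_continuous_onD[OF ac(2) \<open>0 < \<epsilon> / 2\<close>] by (elim exE conjE)
  have "(\<Sum>k<N. norm (?\<chi> (b' k) - ?\<chi> (a' k))) < \<epsilon>"
    if I: "\<forall>k<N. a' k \<le> b' k \<and> {a' k..b' k} \<subseteq> {a..b}"
      and disj: "disjoint_family_on (\<lambda>k. {a' k<..<b' k}) {..<N}"
      and s: "(\<Sum>k<N. b' k - a' k) < min \<delta>1 \<delta>2"
    for N :: nat and a' b'
  proof -
    have I': "a \<le> a' k" "a' k \<le> b' k" "b' k \<le> b" if "k < N" for k
      using I that by auto
    have sub: "(\<Sum>k<N. min (b' k) c - min (a' k) c) < \<delta>1" "(\<Sum>k<N. max (b' k) c - max (a' k) c) < \<delta>2"
    proof -
      have "(\<Sum>k<N. min (b' k) c - min (a' k) c) \<le> (\<Sum>k<N. b' k - a' k)"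
        "(\<Sum>k<N. max (b' k) c - max (a' k) c) \<le> (\<Sum>k<N. b' k - a' k)"
        using I'(2) by (intro sum_mono; force)+
      with s show "(\<Sum>k<N. min (b' k) c - min (a' k) c) < \<delta>1"
        "(\<Sum>k<N. max (b' k) c - max (a' k) c) < \<delta>2" by simp_all
    qed
    have "(\<Sum>k<N. norm (\<phi> (min (b' k) c) - \<phi> (min (a' k) c))) < \<epsilon> / 2"
    proof (rule \<delta>1[rule_format])
      show "min (a' k) c \<le> min (b' k) c \<and> {min (a' k) c..min (b' k) c} \<subseteq> {a..c}" if "k < N" for k
        using I'[OF that] acb by auto
      show "disjoint_family_on (\<lambda>k. {min (a' k) c<..<min (b' k) c}) {..<N}"
        using disj unfolding disjoint_family_on_def by (fastforce simp: min_less_iff_disj)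
    qed (rule sub)
    moreover have "(\<Sum>k<N. norm (\<psi> (max (b' k) c) - \<psi> (max (a' k) c))) < \<epsilon> / 2"
    proof (rule \<delta>2[rule_format])
      show "max (a' k) c \<le> max (b' k) c \<and> {max (a' k) c..max (b' k) c} \<subseteq> {c..b}" if "k < N" for k
        using I'[OF that] acb by auto
      show "disjoint_family_on (\<lambda>k. {max (a' k) c<..<max (b' k) c}) {..<N}"
        using disj unfolding disjoint_family_on_def by (fastforce simp: less_max_iff_disj)
    qed (rule sub)
    moreover have "(\<Sum>k<N. norm (?\<chi> (b' k) - ?\<chi> (a' k))) \<le>
      (\<Sum>k<N. norm (\<phi> (min (b' k) c) - \<phi> (min (a' k) c)) + norm (\<psi> (max (b' k) c) - \<psi> (max (a' k) c)))"
    proof (rule sum_mono)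
      \<comment> \<open>Since \<open>\<phi> c = \<psi> c\<close>, one of the two summands is constant on either side of \<open>c\<close>.\<close>
      have split: "?\<chi> \<tau> = \<phi> (min \<tau> c) + (\<psi> (max \<tau> c) - \<psi> c)" for \<tau>
        by (auto simp: eq min_def max_def)
      show "norm (?\<chi> (b' k) - ?\<chi> (a' k)) \<le>
        norm (\<phi> (min (b' k) c) - \<phi> (min (a' k) c)) + norm (\<psi> (max (b' k) c) - \<psi> (max (a' k) c))" for k
        using norm_triangle_ineq[of "\<phi> (min (b' k) c) - \<phi> (min (a' k) c)" "\<psi> (max (b' k) c) - \<psi> (max (a' k) c)"]
        unfolding split by (simp add: algebra_simps)
    qed
    ultimately show ?thesis by (simp add: sum.distrib)
  qed
  then show "\<exists>\<delta>>0. \<forall>(N::nat) a' b'. (\<forall>k<N. a' k \<le> b' k \<and> {a' k..b' k} \<subseteq> {a..b}) \<and>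
      disjoint_family_on (\<lambda>k. {a' k<..<b' k}) {..<N} \<and> (\<Sum>k<N. b' k - a' k) < \<delta> \<longrightarrow>
      (\<Sum>k<N. norm (?\<chi> (b' k) - ?\<chi> (a' k))) < \<epsilon>"
    using \<open>\<delta>1 > 0\<close> \<open>\<delta>2 > 0\<close> by (intro exI[of _ "min \<delta>1 \<delta>2"]) auto
qed

text \<open>The Picard-Lindeloef theorem for a globally Lipschitz right-hand side, on an interval of arbitrary
  length. In the norm with weight \<open>exp (-2K\<tau>)\<close>, where \<open>K\<close> exceeds the Lipschitz constant, the integral
  operator is a contraction with constant \<open>1/2\<close> on the whole interval at once. The weight is absorbed
  into the unknown \<open>z\<close>, with \<open>y \<tau> = exp (2K\<tau>) z \<tau>\<close>, so that the metric is the usual supremum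
  distance.\<close>

lemma lipschitz_ode_solution_exists:
  fixes f :: "'a::euclidean_space \<Rightarrow> 'a"
  assumes f: "L-lipschitz_on UNIV f" and ab: "a \<le> b"
  shows "\<exists>y. y a = y0 \<and> (\<forall>\<tau>\<in>{a..b}. (y has_vector_derivative f (y \<tau>)) (at \<tau> within {a..b}))"
proof -
  define K where "K = L + 1"
  have L: "0 \<le> L" using f by (rule lipschitz_on_nonneg)
  then have K: "0 < K" by (simp add: K_def)
  have f_cont: "continuous_on UNIV f" using f by (rule lipschitz_on_continuous_on)
  define g where "g z s = f (exp (2 * K * s) *\<^sub>R apply_bcontfun z s)" for z :: "real \<Rightarrow>\<^sub>C 'a" and s
  have g_cont: "continuous_on I (g z)" for z I
    unfolding g_def by (intro continuous_on_compose2[OF f_cont] continuous_intros) auto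
  then have g_int: "g z integrable_on {a..\<sigma>}" for z \<sigma>
    by (rule integrable_continuous_real)
  define h where "h z \<sigma> = exp (- 2 * K * \<sigma>) *\<^sub>R (y0 + integral {a..\<sigma>} (g z))" for z \<sigma>
  \<comment> \<open>Composition with the retraction onto \<open>[a, b]\<close> turns functions on the interval into bounded
    continuous functions on the line.\<close>
  define c where "c \<tau> = max a (min b \<tau>)" for \<tau>
  have c: "c \<tau> \<in> {a..b}" "continuous_on UNIV c" "\<tau> \<in> {a..b} \<Longrightarrow> c \<tau> = \<tau>" for \<tau>
    using ab by (auto simp: c_def intro!: continuous_intros)
  have h_cont: "continuous_on {a..b} (h z)" for z
    unfolding h_def by (intro continuous_intros indefinite_integral_continuous_1 g_int)
  have h_bcontfun: "h z \<circ> c \<in> bcontfun" for z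
  proof -
    have "continuous_on UNIV (h z \<circ> c)"
      unfolding o_def using c by (intro continuous_on_compose2[OF h_cont]) auto
    moreover have "bounded (range (h z \<circ> c))"
      using c(1) compact_imp_bounded[OF compact_continuous_image[OF h_cont compact_Icc]]
      by (rule_tac bounded_subset[of "h z ` {a..b}"]) auto
    ultimately show ?thesis by (simp add: bcontfun_def)
  qed
  define \<Psi> where "\<Psi> z = Bcontfun (h z \<circ> c)" for z
  have \<Psi>: "apply_bcontfun (\<Psi> z) \<tau> = h z (c \<tau>)" for z \<tau>
    by (simp add: \<Psi>_def Bcontfun_inverse[OF h_bcontfun])
  have contract: "dist (\<Psi> z) (\<Psi> w) \<le> 1/2 * dist z w" for z w
  proof (rule dist_bound)
    fix \<tau>
    define \<sigma> where "\<sigma> = c \<tau>"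
    have \<sigma>: "a \<le> \<sigma>" "\<sigma> \<le> b" using c(1)[of \<tau>] by (auto simp: \<sigma>_def)
    \<comment> \<open>The antiderivative of \<open>K dist z w exp (2Ks)\<close>.\<close>
    define E where "E s = dist z w / 2 * exp (2 * K * s)" for s
    have E: "((\<lambda>s. K * dist z w * exp (2 * K * s)) has_integral (E \<sigma> - E a)) {a..\<sigma>}"
    proof (rule fundamental_theorem_of_calculus[OF \<sigma>(1)])
      show "(E has_vector_derivative K * dist z w * exp (2 * K * s)) (at s within {a..\<sigma>})" for s
        unfolding E_def has_real_derivative_iff_has_vector_derivative[symmetric]
        by (auto intro!: derivative_eq_intros)
    qed
    have "norm (integral {a..\<sigma>} (g z) - integral {a..\<sigma>} (g w)) = norm (integral {a..\<sigma>} (\<lambda>s. g z s - g w s))"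
      by (simp add: integral_diff g_int)
    also have "\<dots> \<le> integral {a..\<sigma>} (\<lambda>s. K * dist z w * exp (2 * K * s))"
    proof (rule integral_norm_bound_integral)
      show "norm (g z s - g w s) \<le> K * dist z w * exp (2 * K * s)" for s
      proof -
        have "norm (g z s - g w s) \<le> L * (exp (2 * K * s) * dist (z s) (w s))"
          using lipschitz_onD[OF f, of "exp (2 * K * s) *\<^sub>R z s" "exp (2 * K * s) *\<^sub>R w s"]
          by (simp add: g_def dist_norm flip: scaleR_diff_right)
        also have "\<dots> \<le> K * (exp (2 * K * s) * dist z w)"
          using L by (intro mult_mono mult_nonneg_nonneg dist_bounded) (auto simp: K_def)
        finally show ?thesis by (simp add: mult_ac)
      qed
    qed (use E in \<open>auto intro!: integrable_diff g_int simp: has_integral_integrable_integral\<close>)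
    also have "\<dots> = E \<sigma> - E a" using E by (rule integral_unique)
    also have "\<dots> \<le> E \<sigma>" by (simp add: E_def)
    finally have int_le: "norm (integral {a..\<sigma>} (g z) - integral {a..\<sigma>} (g w)) \<le> E \<sigma>" .
    have "dist (\<Psi> z \<tau>) (\<Psi> w \<tau>) = exp (- 2 * K * \<sigma>) * norm (integral {a..\<sigma>} (g z) - integral {a..\<sigma>} (g w))"
      by (simp add: \<Psi> h_def dist_norm flip: \<sigma>_def scaleR_diff_right)
    also have "\<dots> \<le> exp (- 2 * K * \<sigma>) * E \<sigma>"
      using int_le by (intro mult_left_mono) auto
    also have "\<dots> = 1/2 * dist z w"
      by (simp add: E_def exp_minus field_simps)
    finally show "dist (\<Psi> z \<tau>) (\<Psi> w \<tau>) \<le> 1/2 * dist z w" .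
  qed
  then obtain z where z: "\<Psi> z = z"
    using banach_fix_type[of "1/2" \<Psi>] by auto
  define y where "y \<tau> = exp (2 * K * \<tau>) *\<^sub>R apply_bcontfun z \<tau>" for \<tau>
  have y: "y \<tau> = y0 + integral {a..\<tau>} (g z)" if "\<tau> \<in> {a..b}" for \<tau>
  proof -
    have "apply_bcontfun z \<tau> = h z \<tau>" using \<Psi>[of z \<tau>] z c(3)[OF that] by simp
    then show ?thesis by (simp add: y_def h_def flip: exp_add)
  qed
  have gz: "g z = (\<lambda>s. f (y s))" by (auto simp: g_def y_def)
  have "(y has_vector_derivative f (y \<tau>)) (at \<tau> within {a..b})" if "\<tau> \<in> {a..b}" for \<tau>
  proof (rule has_vector_derivative_transform[OF that, of _ "\<lambda>\<tau>. y0 + integral {a..\<tau>} (g z)"])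
    show "((\<lambda>\<tau>. y0 + integral {a..\<tau>} (g z)) has_vector_derivative f (y \<tau>)) (at \<tau> within {a..b})"
      using integral_has_vector_derivative[OF g_cont that, of z] unfolding gz
      by (auto intro!: derivative_eq_intros)
  qed (use y in auto)
  moreover have "y a = y0" using y[of a] ab by simp
  ultimately show ?thesis by blast
qed

lemma C1_imp_abs_continuous_on:
  fixes y :: "real \<Rightarrow> 'a::euclidean_space"
  assumes y: "\<And>\<tau>. \<tau> \<in> {a..b} \<Longrightarrow> (y has_vector_derivative y' \<tau>) (at \<tau> within {a..b})"
    and y': "continuous_on {a..b} y'"
  shows "abs_continuous_on {a..b} y"
proof -
  have "bounded (y' ` {a..b})"
    by (intro compact_imp_bounded compact_continuous_image y') simp
  then obtain B where B: "0 \<le> B" "\<And>\<tau>. \<tau> \<in> {a..b} \<Longrightarrow> norm (y' \<tau>) \<le> B"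
    unfolding bounded_pos by (metis imageI less_imp_le)
  have "B-lipschitz_on {a..b} y"
  proof (rule bounded_derivative_imp_lipschitz)
    show "(y has_derivative (\<lambda>h. h *\<^sub>R y' \<tau>)) (at \<tau> within {a..b})" if "\<tau> \<in> {a..b}" for \<tau>
      using y[OF that] by (simp add: has_vector_derivative_def)
    show "onorm (\<lambda>h. h *\<^sub>R y' \<tau>) \<le> B" if "\<tau> \<in> {a..b}" for \<tau>
      using B(2)[OF that] by (intro onorm_le) (auto simp: mult.commute[of B] mult_left_mono)
  qed (use B in auto)
  then show ?thesis by (rule lipschitz_imp_abs_continuous_on)
qed

section \<open>Control signals along trajectories\<close>

text \<open>Discarding the two end points makes one-sided derivatives disappear from the equations.\<close>

lemma AE_lebesgue_on_iff_interior:
  fixes a b :: real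
  shows "(AE \<tau> in lebesgue_on {a..b}. P \<tau>) \<longleftrightarrow> (AE \<tau> in lebesgue. a < \<tau> \<and> \<tau> < b \<longrightarrow> P \<tau>)"
proof -
  have "AE \<tau> in lebesgue. \<tau> \<noteq> a" "AE \<tau> in lebesgue. \<tau> \<noteq> b"
    by (intro AE_completion AE_lborel_singleton)+
  then have "(AE \<tau> in lebesgue. \<tau> \<in> {a..b} \<longrightarrow> P \<tau>) \<longleftrightarrow> (AE \<tau> in lebesgue. a < \<tau> \<and> \<tau> < b \<longrightarrow> P \<tau>)"
  proof (intro iffI)
    assume "AE \<tau> in lebesgue. \<tau> \<in> {a..b} \<longrightarrow> P \<tau>"
    then show "AE \<tau> in lebesgue. a < \<tau> \<and> \<tau> < b \<longrightarrow> P \<tau>" by eventually_elim auto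
  next
    assume "AE \<tau> in lebesgue. \<tau> \<noteq> a" "AE \<tau> in lebesgue. \<tau> \<noteq> b"
      and "AE \<tau> in lebesgue. a < \<tau> \<and> \<tau> < b \<longrightarrow> P \<tau>"
    then show "AE \<tau> in lebesgue. \<tau> \<in> {a..b} \<longrightarrow> P \<tau>" by eventually_elim auto
  qed
  then show ?thesis by (simp add: AE_restrict_space_iff)
qed

text \<open>Under zero control the system is an autonomous equation with a Lipschitz right-hand side, so a
  trajectory can be prolonged indefinitely.\<close>

lemma solves_control_extend:
  fixes F :: "real^'n \<Rightarrow> real^'m \<Rightarrow> real^'n"
  assumes sol: "solves_control F \<Omega> u x0 t \<phi>" and t: "0 \<le> t" "t \<le> T"
    and drift: "L-lipschitz_on UNIV (\<lambda>x. F x 0)" and zero: "0 \<in> \<Omega>"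
  shows "\<exists>u' \<psi>. solves_control F \<Omega> u' x0 T \<psi> \<and> \<psi> t = \<phi> t"
proof -
  obtain y where y0: "y t = \<phi> t"
    and y: "\<And>\<tau>. \<tau> \<in> {t..T} \<Longrightarrow> (y has_vector_derivative F (y \<tau>) 0) (at \<tau> within {t..T})"
    using lipschitz_ode_solution_exists[OF drift t(2), of "\<phi> t"] by auto
  define u' where "u' \<tau> = (if \<tau> \<in> {0..t} then u \<tau> else 0)" for \<tau>
  define \<psi> where "\<psi> \<tau> = (if \<tau> \<le> t then \<phi> \<tau> else y \<tau>)" for \<tau>
  have "continuous_on {t..T} y"
    using y has_vector_derivative_continuous continuous_on_eq_continuous_within by blast
  then have "continuous_on {t..T} (\<lambda>\<tau>. F (y \<tau>) 0)"
    by (rule continuous_on_compose2[OF lipschitz_on_continuous_on[OF drift]]) auto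
  then have "abs_continuous_on {t..T} y"
    using y by (rule C1_imp_abs_continuous_on[rotated])
  then have "abs_continuous_on {0..T} \<psi>"
    using sol y0 t unfolding \<psi>_def[abs_def] solves_control_def by (intro abs_continuous_on_glue) auto
  moreover have "u' \<in> borel_measurable (lebesgue_on {0..T})"
    using sol t unfolding u'_def[abs_def] solves_control_def by (subst borel_measurable_if_lebesgue_on) auto
  moreover have "u' ` {0..T} \<subseteq> \<Omega>"
    using sol zero by (auto simp: u'_def solves_control_def)
  moreover have "AE \<tau> in lebesgue_on {0..T}. (\<psi> has_vector_derivative F (\<psi> \<tau>) (u' \<tau>)) (at \<tau> within {0..T})"
    unfolding AE_lebesgue_on_iff_interior
  proof -
    have "AE \<tau> in lebesgue. 0 < \<tau> \<and> \<tau> < t \<longrightarrow> (\<phi> has_vector_derivative F (\<phi> \<tau>) (u \<tau>)) (at \<tau> within {0..t})"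
      using sol by (simp add: solves_control_def AE_lebesgue_on_iff_interior)
    moreover have "AE \<tau> in lebesgue. \<tau> \<noteq> t"
      by (intro AE_completion AE_lborel_singleton)
    ultimately show "AE \<tau> in lebesgue. 0 < \<tau> \<and> \<tau> < T \<longrightarrow>
        (\<psi> has_vector_derivative F (\<psi> \<tau>) (u' \<tau>)) (at \<tau> within {0..T})"
    proof eventually_elim
      case (elim \<tau>)
      show ?case
      proof
        assume \<tau>: "0 < \<tau> \<and> \<tau> < T"
        then have at: "at \<tau> within {0..T} = at \<tau>" by (simp add: at_within_Icc_at)
        show "(\<psi> has_vector_derivative F (\<psi> \<tau>) (u' \<tau>)) (at \<tau> within {0..T})"
        proof (cases "\<tau> < t")
          case True
          then have "(\<phi> has_vector_derivative F (\<psi> \<tau>) (u' \<tau>)) (at \<tau>)"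
            using elim \<tau> by (simp add: at_within_Icc_at \<psi>_def u'_def)
          then show ?thesis unfolding at
            using True \<tau> by (rule_tac has_vector_derivative_transform_within_open[of _ _ _ "{0<..<t}"]) (auto simp: \<psi>_def)
        next
          case False
          with elim have "t < \<tau>" by simp
          then have "(y has_vector_derivative F (\<psi> \<tau>) (u' \<tau>)) (at \<tau>)"
            using y[of \<tau>] \<tau> by (simp add: at_within_Icc_at \<psi>_def u'_def)
          then show ?thesis unfolding at
            using \<open>t < \<tau>\<close> \<tau> by (rule_tac has_vector_derivative_transform_within_open[of _ _ _ "{t<..<T}"]) (auto simp: \<psi>_def)
        qed
      qed
    qed
  qed
  moreover have "\<psi> 0 = x0"
    using sol t by (simp add: \<psi>_def solves_control_def)
  ultimately have "solves_control F \<Omega> u' x0 T \<psi>"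
    by (simp add: solves_control_def)
  moreover have "\<psi> t = \<phi> t" by (simp add: \<psi>_def)
  ultimately show ?thesis by blast
qed

text \<open>The limit of difference quotients with step \<open>1/n\<close> is measurable whether or not the function is
  differentiable, if divergent sequences are given the default value of \<open>lim\<close>.\<close>

lemma derivative_measurable:
  fixes \<phi> :: "real \<Rightarrow> 'a::euclidean_space"
  assumes \<phi>: "continuous_on {a..b} \<phi>" and ab: "a \<le> b"
  obtains \<phi>' where "\<phi>' \<in> borel_measurable lebesgue"
    and "\<And>\<tau> v. a < \<tau> \<Longrightarrow> \<tau> < b \<Longrightarrow> (\<phi> has_vector_derivative v) (at \<tau> within {a..b}) \<Longrightarrow> \<phi>' \<tau> = v"
proof
  define c where "c \<tau> = max a (min b \<tau>)" for \<tau>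
  define \<psi> where "\<psi> \<tau> = \<phi> (c \<tau>)" for \<tau>
  have \<psi>: "continuous_on UNIV \<psi>"
    unfolding \<psi>_def c_def using ab by (intro continuous_on_compose2[OF \<phi>] continuous_intros) auto
  define Q where "Q n \<tau> = real (Suc n) *\<^sub>R (\<psi> (\<tau> + 1 / real (Suc n)) - \<psi> \<tau>)" for n \<tau>
  have "continuous_on UNIV (Q n)" for n
    unfolding Q_def by (intro continuous_intros continuous_on_compose2[OF \<psi>]) auto
  then have "Q n \<in> borel_measurable lebesgue" for n
    by (intro measurable_completion) (simp add: borel_measurable_continuous_onI)
  then show "(\<lambda>\<tau>. lim (\<lambda>n. Q n \<tau>)) \<in> borel_measurable lebesgue"
    by (intro borel_measurable_lim_metric)
  fix \<tau> v assume \<tau>: "a < \<tau>" "\<tau> < b" and v: "(\<phi> has_vector_derivative v) (at \<tau> within {a..b})"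
  then have "(\<phi> has_vector_derivative v) (at \<tau>)" by (simp add: at_within_Icc_at)
  then have "(\<psi> has_vector_derivative v) (at \<tau>)"
    using \<tau> by (rule_tac has_vector_derivative_transform_within_open[of _ _ _ "{a<..<b}"])
      (auto simp: \<psi>_def c_def)
  then have "((\<lambda>y. norm ((\<psi> y - \<psi> \<tau>) - (y - \<tau>) *\<^sub>R v) / norm (y - \<tau>)) \<longlongrightarrow> 0) (at \<tau>)"
    by (simp add: has_vector_derivative_def has_derivative_iff_norm)
  moreover have "filterlim (\<lambda>n. \<tau> + 1 / real (Suc n)) (at \<tau>) sequentially"
    unfolding filterlim_at using tendsto_add[OF tendsto_const LIMSEQ_Suc[OF lim_1_over_n], of \<tau>] by auto
  ultimately have "(\<lambda>n. norm ((\<psi> (\<tau> + 1 / real (Suc n)) - \<psi> \<tau>) - (1 / real (Suc n)) *\<^sub>R v) / norm (1 / real (Suc n)))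
      \<longlonglongrightarrow> 0"
    by (auto dest: filterlim_compose)
  moreover have "norm ((\<psi> (\<tau> + 1 / real (Suc n)) - \<psi> \<tau>) - (1 / real (Suc n)) *\<^sub>R v) / norm (1 / real (Suc n))
      = norm (Q n \<tau> - v)" for n
  proof -
    have "Q n \<tau> - v = real (Suc n) *\<^sub>R ((\<psi> (\<tau> + 1 / real (Suc n)) - \<psi> \<tau>) - (1 / real (Suc n)) *\<^sub>R v)"
      by (simp add: Q_def scaleR_right_diff_distrib del: of_nat_Suc)
    then show ?thesis by (simp del: of_nat_Suc)
  qed
  ultimately have "(\<lambda>n. Q n \<tau>) \<longlonglongrightarrow> v"
    by (simp add: LIM_zero_iff tendsto_norm_zero_iff)
  then show "lim (\<lambda>n. Q n \<tau>) = v" by (rule limI)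
qed

section \<open>Comparison of the reachable sets\<close>

lemma op_lipschitz_entry_continuous:
  fixes G :: "real^'n \<Rightarrow> real^'m^'n"
  assumes "op_lipschitz L G"
  shows "continuous_on UNIV (\<lambda>x. G x $ i $ j)"
proof -
  have "\<bar>L\<bar>-lipschitz_on UNIV (\<lambda>x. G x $ i $ j)"
  proof (rule lipschitz_onI)
    fix x y
    have "((G x - G y) *v axis j 1) $ i = G x $ i $ j - G y $ i $ j"
      unfolding matrix_vector_mult_basis by (simp add: column_def)
    then have "dist (G x $ i $ j) (G y $ i $ j) \<le> norm ((G x - G y) *v axis j 1)"
      using component_le_norm_cart[of "(G x - G y) *v axis j 1" i] by (simp add: dist_norm)
    also have "\<dots> \<le> opnorm (G x - G y)"
      using norm_mult_le_opnorm[of "G x - G y" "axis j 1"] by simp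
    also have "\<dots> \<le> L * norm (x - y)"
      using assms by (simp add: op_lipschitz_def)
    also have "\<dots> \<le> \<bar>L\<bar> * dist x y"
      by (simp add: dist_norm mult_right_mono)
    finally show "dist (G x $ i $ j) (G y $ i $ j) \<le> \<bar>L\<bar> * dist x y" .
  qed simp
  then show ?thesis by (rule lipschitz_on_continuous_on)
qed

lemma borel_measurable_compose_trajectory:
  fixes g :: "real^'n \<Rightarrow> 'b::topological_space"
  assumes "continuous_on {0..t} \<phi>" and "g \<in> borel_measurable borel"
  shows "(\<lambda>\<tau>. g (\<phi> \<tau>)) \<in> borel_measurable (lebesgue_on {0..t::real})"
  using measurable_compose[OF continuous_imp_measurable_on_sets_lebesgue[OF assms(1)] assms(2)] by simp

context velocity_setting
begin

lemma borel_measurable_lam: "(\<lambda>s. lam Lf LG A p U s i) \<in> borel_measurable borel"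
proof (cases "p i \<le> rank A")
  case True
  then have "(\<lambda>s. lam Lf LG A p U s i) = (\<lambda>s. max (gap Lf LG A s /
      (alpha LG A s * norm (pinv A *v column i U) + beta LG A s)) (max (gap Lf LG A s) 0))"
    by (simp add: lam_def fun_eq_iff)
  then show ?thesis
    by (simp add: gap_def alpha_def beta_def)
qed (simp add: lam_def)

lemma borel_measurable_system:
  fixes t :: real
  assumes \<phi>: "continuous_on {0..t} \<phi>" and u: "u \<in> borel_measurable (lebesgue_on {0..t})"
  shows "(\<lambda>\<tau>. system (\<phi> \<tau>) (u \<tau>)) \<in> borel_measurable (lebesgue_on {0..t})"
proof -
  have "(\<lambda>x::real^'n. if p k = q j then lam Lf LG A p U (norm x) k else 0) \<in> borel_measurable borel" for k j
    by (cases "p k = q j") (auto intro: measurable_compose[OF _ borel_measurable_lam])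
  then have "(\<lambda>x::real^'n. (U ** Lam Lf LG A p q U (norm x)) $ i $ j) \<in> borel_measurable borel" for i j
    unfolding Lam_def rect_diag_def matrix_matrix_mult_def
    by (auto intro!: borel_measurable_sum borel_measurable_times)
  from borel_measurable_matrix_mult[OF borel_measurable_compose_trajectory[OF \<phi> this] u]
  show ?thesis
    unfolding svd_system_def by (intro borel_measurable_add) auto
qed

lemma reach_control_subset_inclusion:
  "reach_on states system controls T 0 \<subseteq>
    reach_inclusion_on states (\<lambda>x. convex hull (S_set Lf LG f0 A R U x)) T 0"
proof
  fix y assume "y \<in> reach_on states system controls T 0"
  then obtain u \<phi> t where y: "y = \<phi> t" "t \<in> {0..T}" "\<phi> ` {0..t} \<subseteq> states"
    and sol: "solves_control system controls u 0 t \<phi>"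
    unfolding reach_on_def by blast
  from sol have u: "u ` {0..t} \<subseteq> controls"
    and ae: "AE \<tau> in lebesgue_on {0..t}. (\<phi> has_vector_derivative system (\<phi> \<tau>) (u \<tau>)) (at \<tau> within {0..t})"
    by (auto simp: solves_control_def)
  have "AE \<tau> in lebesgue_on {0..t}. \<tau> \<in> {0..t}"
    by (rule AE_I2) simp
  with ae have "AE \<tau> in lebesgue_on {0..t}. \<exists>v\<in>convex hull (S_set Lf LG f0 A R U (\<phi> \<tau>)).
      (\<phi> has_vector_derivative v) (at \<tau> within {0..t})"
  proof eventually_elim
    case (elim \<tau>)
    then have "system (\<phi> \<tau>) (u \<tau>) \<in> convex hull (S_set Lf LG f0 A R U (\<phi> \<tau>))"
      using y(3) u by (subst hull_eq) (simp_all add: image_subset_iff)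
    with elim show ?case by blast
  qed
  with sol have "solves_inclusion (\<lambda>x. convex hull (S_set Lf LG f0 A R U x)) 0 t \<phi>"
    by (simp add: solves_inclusion_def solves_control_def)
  with y show "y \<in> reach_inclusion_on states (\<lambda>x. convex hull (S_set Lf LG f0 A R U x)) T 0"
    unfolding reach_inclusion_on_def by blast
qed

text \<open>The control recovered from the derivative is admissible only almost everywhere, whereas a control
  has to take its values in the control set at every time. As the recovered control is always supported
  on the active coordinates, the 1-norm alone decides where it is to be replaced by \<open>0\<close>.\<close>

lemma reach_inclusion_subset_control:
  "reach_inclusion_on states (\<lambda>x. convex hull (S_set Lf LG f0 A R U x)) T 0 \<subseteq>
    reach_on states system controls T 0"
proof
  fix y assume "y \<in> reach_inclusion_on states (\<lambda>x. convex hull (S_set Lf LG f0 A R U x)) T 0"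
  then obtain \<phi> t where y: "y = \<phi> t" "t \<in> {0..T}" "\<phi> ` {0..t} \<subseteq> states"
    and sol: "solves_inclusion (\<lambda>x. convex hull (S_set Lf LG f0 A R U x)) 0 t \<phi>"
    unfolding reach_inclusion_on_def by blast
  from sol have \<phi>: "continuous_on {0..t} \<phi>"
    unfolding solves_inclusion_def by (blast intro: abs_continuous_on_imp_continuous_on)
  have "0 \<le> t" using y by simp
  obtain \<phi>' where \<phi>'_meas: "\<phi>' \<in> borel_measurable lebesgue"
    and \<phi>': "\<And>\<tau> v. 0 < \<tau> \<Longrightarrow> \<tau> < t \<Longrightarrow> (\<phi> has_vector_derivative v) (at \<tau> within {0..t}) \<Longrightarrow> \<phi>' \<tau> = v"
    by (rule derivative_measurable[OF \<phi> \<open>0 \<le> t\<close>]) blast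
  define w where "w \<tau> = recovered_control (norm (\<phi> \<tau>)) (\<phi>' \<tau>)" for \<tau>
  define u where "u \<tau> = (if norm1 (w \<tau>) \<le> 1 then w \<tau> else 0)" for \<tau>
  have "(\<lambda>\<tau>. transpose U *v (\<phi>' \<tau> - f0)) \<in> borel_measurable (lebesgue_on {0..t})"
    by (intro borel_measurable_matrix_mult borel_measurable_diff measurable_restrict_space1[OF \<phi>'_meas]) auto
  then have "(\<lambda>\<tau>. (transpose U *v (\<phi>' \<tau> - f0)) $ i) \<in> borel_measurable (lebesgue_on {0..t})" for i
    unfolding borel_measurable_vec_iff by blast
  moreover have "(\<lambda>\<tau>. lam Lf LG A p U (norm (\<phi> \<tau>)) i) \<in> borel_measurable (lebesgue_on {0..t})" for i
    by (intro borel_measurable_compose_trajectory[OF \<phi>] measurable_compose[OF _ borel_measurable_lam]) auto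
  ultimately have w: "w \<in> borel_measurable (lebesgue_on {0..t})"
    unfolding borel_measurable_vec_iff w_def recovered_control_def by auto
  then have "(\<lambda>\<tau>. norm1 (w \<tau>)) \<in> borel_measurable (lebesgue_on {0..t})"
    unfolding borel_measurable_vec_iff norm1_def
    by (auto intro!: borel_measurable_sum borel_measurable_abs)
  then have "u \<in> borel_measurable (lebesgue_on {0..t})"
    unfolding u_def using w by measurable
  moreover have "u ` {0..t} \<subseteq> controls"
    by (auto simp: controls_eq u_def w_def recovered_control_def norm1_def)
  moreover have "AE \<tau> in lebesgue_on {0..t}. (\<phi> has_vector_derivative system (\<phi> \<tau>) (u \<tau>)) (at \<tau> within {0..t})"
  proof -
    have "AE \<tau> in lebesgue. 0 < \<tau> \<and> \<tau> < t \<longrightarrow> (\<exists>v\<in>convex hull (S_set Lf LG f0 A R U (\<phi> \<tau>)).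
        (\<phi> has_vector_derivative v) (at \<tau> within {0..t}))"
      using sol by (simp add: solves_inclusion_def AE_lebesgue_on_iff_interior)
    then show ?thesis
      unfolding AE_lebesgue_on_iff_interior
    proof eventually_elim
      case (elim \<tau>)
      show ?case
      proof
        assume \<tau>: "0 < \<tau> \<and> \<tau> < t"
        with elim obtain v where v: "v \<in> convex hull (S_set Lf LG f0 A R U (\<phi> \<tau>))"
          and d: "(\<phi> has_vector_derivative v) (at \<tau> within {0..t})" by blast
        have "\<phi> \<tau> \<in> states" using y(3) \<tau> by auto
        from v[unfolded hull_eq[OF this]] obtain c where c: "c \<in> controls" "v = system (\<phi> \<tau>) c" by blast
        have "w \<tau> = recovered_control (norm (\<phi> \<tau>)) (system (\<phi> \<tau>) c)"
          using \<phi>'[of \<tau> v] \<tau> d c by (simp add: w_def)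
        then have "w \<tau> \<in> controls" "system (\<phi> \<tau>) (w \<tau>) = v"
          using recovered_control[OF c(1)] c(2) by simp_all
        then have "system (\<phi> \<tau>) (u \<tau>) = v" by (simp add: u_def controls_eq)
        with d show "(\<phi> has_vector_derivative system (\<phi> \<tau>) (u \<tau>)) (at \<tau> within {0..t})" by simp
      qed
    qed
  qed
  ultimately have "solves_control system controls u 0 t \<phi>"
    using sol by (simp add: solves_control_def solves_inclusion_def)
  with y show "y \<in> reach_on states system controls T 0"
    unfolding reach_on_def by blast
qed

text \<open>A consistent system follows the very same trajectory: among the controls that produce the required
  velocity, the one of least norm is at most as large as the one known to lie in the unit ball, and it
  is measurable.\<close>

lemma reach_subset_guaranteed:
  assumes \<Omega>: "\<Omega> \<subseteq> {u. norm1 u \<le> 1}"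
  shows "reach_on states system \<Omega> T 0 \<subseteq> guaranteed_reach Lf LG f0 A T 0"
proof
  fix y assume "y \<in> reach_on states system \<Omega> T 0"
  then obtain u \<phi> t where y: "y = \<phi> t" "t \<in> {0..T}" "\<phi> ` {0..t} \<subseteq> states"
    and sol: "solves_control system \<Omega> u 0 t \<phi>"
    unfolding reach_on_def by blast
  have \<phi>: "continuous_on {0..t} \<phi>"
    using sol unfolding solves_control_def by (blast intro: abs_continuous_on_imp_continuous_on)
  have "y \<in> reach (affine_system f G) (cball 0 1) T 0" if con: "(f, G) \<in> D_con Lf LG f0 A" for f G
  proof -
    have f: "Lf-lipschitz_on UNIV f" and G: "op_lipschitz LG G"
      using con by (auto simp: D_con_def)
    define z where "z \<tau> = system (\<phi> \<tau>) (u \<tau>) - f (\<phi> \<tau>)" for \<tau>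
    define w where "w \<tau> = least_norm_solution A X (G (\<phi> \<tau>)) (z \<tau>)" for \<tau>
    have w: "norm (w \<tau>) \<le> 1" "affine_system f G (\<phi> \<tau>) (w \<tau>) = system (\<phi> \<tau>) (u \<tau>)" if "\<tau> \<in> {0..t}" for \<tau>
    proof -
      have x: "\<phi> \<tau> \<in> states" using y(3) that by auto
      have "norm1 (u \<tau>) \<le> 1" using sol \<Omega> that unfolding solves_control_def by blast
      from system_velocity_realizable[OF con x this] obtain c
        where c: "norm c \<le> 1" "G (\<phi> \<tau>) *v c = z \<tau>" by (auto simp: z_def algebra_simps)
      interpret P: range_preserving_perturbation A "G (\<phi> \<tau>)" X "LG * norm (\<phi> \<tau>)"
        using consistent_perturbation[OF Lf LG is_pinv_X A con x] .
      have "z \<tau> \<in> Ran A"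
        unfolding c(2)[symmetric] by (rule subsetD[OF P.Ran_le rangeI])
      then have "G (\<phi> \<tau>) *v w \<tau> = z \<tau>" "norm (w \<tau>) \<le> norm c"
        unfolding w_def using P.least_norm_solution P.least_norm_solution_minimal[OF _ c(2)] by simp_all
      with c(1) show "norm (w \<tau>) \<le> 1" "affine_system f G (\<phi> \<tau>) (w \<tau>) = system (\<phi> \<tau>) (u \<tau>)"
        by (simp_all add: affine_system_def z_def)
    qed
    have "z \<in> borel_measurable (lebesgue_on {0..t})"
      unfolding z_def
    proof (rule borel_measurable_diff)
      show "(\<lambda>\<tau>. system (\<phi> \<tau>) (u \<tau>)) \<in> borel_measurable (lebesgue_on {0..t})"
        using sol by (intro borel_measurable_system \<phi>) (simp add: solves_control_def)
      show "(\<lambda>\<tau>. f (\<phi> \<tau>)) \<in> borel_measurable (lebesgue_on {0..t})"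
        by (intro borel_measurable_compose_trajectory[OF \<phi>] borel_measurable_continuous_onI
            lipschitz_on_continuous_on[OF f])
    qed
    then have "w \<in> borel_measurable (lebesgue_on {0..t})"
      unfolding w_def
      by (intro borel_measurable_least_norm_solution borel_measurable_compose_trajectory[OF \<phi>]
          borel_measurable_continuous_onI op_lipschitz_entry_continuous[OF G])
    moreover have "w ` {0..t} \<subseteq> cball 0 1" using w by auto
    moreover have "AE \<tau> in lebesgue_on {0..t}.
        (\<phi> has_vector_derivative affine_system f G (\<phi> \<tau>) (w \<tau>)) (at \<tau> within {0..t})"
    proof -
      have "AE \<tau> in lebesgue_on {0..t}. (\<phi> has_vector_derivative system (\<phi> \<tau>) (u \<tau>)) (at \<tau> within {0..t})"
        using sol by (simp add: solves_control_def)
      moreover have "AE \<tau> in lebesgue_on {0..t}. \<tau> \<in> {0..t}"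
        by (rule AE_I2) simp
      ultimately show ?thesis by eventually_elim (simp add: w)
    qed
    ultimately have "solves_control (affine_system f G) (cball 0 1) w 0 t \<phi>"
      using sol by (simp add: solves_control_def)
    moreover have "Lf-lipschitz_on UNIV (\<lambda>x. affine_system f G x 0)"
      using f by (simp add: affine_system_def)
    ultimately obtain w' \<psi> where "solves_control (affine_system f G) (cball 0 1) w' 0 T \<psi>" "\<psi> t = \<phi> t"
      using solves_control_extend[of "affine_system f G" "cball 0 1" w 0 t \<phi> T Lf] y(2) by auto
    with y show ?thesis
      unfolding reach_def by (auto intro!: exI[of _ w'] exI[of _ \<psi>] exI[of _ t])
  qed
  then show "y \<in> guaranteed_reach Lf LG f0 A T 0"
    unfolding guaranteed_reach_def by blast
qed

text \<open>\<open>V\<close> maps \<open>Ran S\<^sup>T\<close> onto \<open>Ran A\<^sup>T\<close>. If the two agree, then \<open>V\<close> is a bijection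
  of this subspace onto itself, so \<open>u\<close> lies in it if and only if \<open>V u\<close> does.\<close>

lemma std_controls_eq_controls:
  assumes "Ran (transpose A) = Ran (transpose S)"
  shows "std_controls A = controls"
proof -
  have "V *v u \<in> Ran (transpose A) \<longleftrightarrow> u \<in> Ran (transpose A)" for u
  proof -
    have "transpose A = V ** transpose S ** transpose U"
      by (subst A_eq) (simp add: matrix_transpose_mul matrix_mul_assoc)
    then have "Ran (transpose A) = (*v) V ` (*v) (transpose S) ` Ran (transpose U)"
      by (simp add: image_image flip: matrix_vector_mul_assoc)
    also have "Ran (transpose U) = UNIV"
      by (metis U_left matrix_vector_mul_assoc matrix_vector_mul_lid surjI)
    finally have "Ran (transpose A) = (*v) V ` Ran (transpose A)"
      using assms by simp
    moreover have "inj ((*v) V)"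
      by (metis V_left injI matrix_vector_mul_assoc matrix_vector_mul_lid)
    ultimately show ?thesis by (metis inj_image_mem_iff)
  qed
  then show ?thesis by (auto simp: std_controls_def svd_controls_def)
qed

end

theorem theorem4:
  fixes f :: "real^'n \<Rightarrow> real^'n" and G :: "real^'n \<Rightarrow> real^'m^'n"
    and R :: "real^'m^'n" and \<rho> :: "real^'n \<Rightarrow> real^'m" and H :: "real^'n \<Rightarrow> real^'m^'m"
    and U :: "real^'n^'n" and S :: "real^'m^'n" and V :: "real^'m^'m"
    and p :: "'n \<Rightarrow> nat" and q :: "'m \<Rightarrow> nat"
    and T Lf LG :: real
  assumes "T \<ge> 0" and "Lf > 0" and "LG > 0"
    and "Lf-lipschitz_on UNIV f" and "op_lipschitz LG G"
    and "factors f G R \<rho> H"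
    and "G 0 \<noteq> 0"
    and "numbering p" and "numbering q"
    and "is_svd p q (G 0) U S V"
  shows "let incl_reach =
              reach_inclusion_on (state_domain Lf LG (G 0))
                (\<lambda>x. convex hull (S_set Lf LG (f 0) (G 0) R U x)) T 0;
            R_hat = (\<lambda>\<Omega>.
              reach_on (state_domain Lf LG (G 0))
                (svd_system Lf LG (f 0) (G 0) p q U) \<Omega> T 0);
            R_guar = guaranteed_reach Lf LG (f 0) (G 0) T 0
          in
            incl_reach = R_hat (svd_controls (G 0) V) \<and>
            R_hat (svd_controls (G 0) V) \<subseteq> R_guar \<and>
            (Ran (transpose (G 0)) = Ran (transpose S) \<longrightarrow>
              incl_reach = R_hat (std_controls (G 0))) \<and>
            R_hat (std_controls (G 0)) \<subseteq> R_guar"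
proof -
  obtain \<sigma> where U: "orthogonal_matrix U" "orthogonal_matrix V" and A: "G 0 = U ** S ** transpose V"
    and S: "S = rect_diag p q \<sigma>" and \<sigma>: "\<And>i. 0 \<le> \<sigma> i" "\<And>i i'. p i \<le> p i' \<Longrightarrow> \<sigma> i' \<le> \<sigma> i"
    using \<open>is_svd p q (G 0) U S V\<close> unfolding is_svd_def by blast
  have "inj p" using \<open>numbering p\<close> by (simp add: numbering_def bij_betw_def)
  define D where "D k = \<sigma> (inv p k)" for k
  have D: "D (p i) = \<sigma> i" for i using \<open>inj p\<close> by (simp add: D_def)
  have S': "S = rect_diag p q (\<lambda>i. D (p i))" by (simp add: S D)
  interpret velocity_setting "G 0" U V p q D R "f 0" Lf LG
    using assms U A \<sigma> factors_Ran[OF \<open>factors f G R \<rho> H\<close>]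
    by unfold_locales (simp_all add: D flip: S)
  have "reach_inclusion_on states (\<lambda>x. convex hull (S_set Lf LG (f 0) (G 0) R U x)) T 0
      = reach_on states system controls T 0"
    by (intro antisym reach_inclusion_subset_control reach_control_subset_inclusion)
  moreover have "reach_on states system controls T 0 \<subseteq> guaranteed_reach Lf LG (f 0) (G 0) T 0"
    by (intro reach_subset_guaranteed) (auto simp: svd_controls_def)
  moreover have "reach_on states system (std_controls (G 0)) T 0 \<subseteq> guaranteed_reach Lf LG (f 0) (G 0) T 0"
    by (intro reach_subset_guaranteed) (auto simp: std_controls_def)
  moreover have "std_controls (G 0) = controls" if "Ran (transpose (G 0)) = Ran (transpose S)"
    using std_controls_eq_controls that unfolding S' by blast
  ultimately show ?thesis
    unfolding Let_def by metis
qed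

end
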